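(* Let $S^1$ be the unit circle considered as a submanifold of $\mathbb{R}^2$, let $k>0$ be an integer, and let $f:S^1\to S^1$ be a $C^{k+1}$ diffeomorphism. Then $f$ extends to a $C^k$ symplectomorphism $\varphi:\mathbb{R}^2\to\mathbb{R}^2$. Furthermore, the extension $\varphi$ near $S^1$ (on a neighborhood of $S^1$) is of the form $\varphi(r,\theta)=(g(r,\theta),f(\theta))$ for some $g$.
   Context: $\mathbb{R}^2$ carries the standard symplectic form $dx\wedge dy$. A $C^k$ symplectomorphism $\varphi:\mathbb{R}^2\to\mathbb{R}^2$ is a $C^k$ diffeomorphism with $\varphi^*(dx\wedge dy)=dx\wedge dy$. Here $(r,\theta)$ are polar coordinates, and $f(\theta)$ denotes the angular coordinate of the image under $f$ of the point of $S^1$ with angular coordinate $\theta$.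
   Formalization: The diffeomorphism f is assumed orientation-preserving; for orientation-reversing f, such as (x,y) -> (x,-y), no extension to a symplectomorphism of the plane exists, since it would map the disc to itself and have negative Jacobian on the circle. *)

theory Defs
  imports "HOL-Analysis.Analysis"
begin

text \<open>For an open set \<open>S\<close>: all iterated directional derivatives of \<open>f\<close> up to
  order \<open>k\<close> exist and are continuous on \<open>S\<close> (fixing the directions \<open>v\<close> keeps the
  codomain unchanged along the recursion).\<close>

primrec Ck_open :: "nat \<Rightarrow> 'a::euclidean_space set \<Rightarrow> ('a \<Rightarrow> 'b::euclidean_space) \<Rightarrow> bool" where
  "Ck_open 0 S f \<longleftrightarrow> continuous_on S f"
| "Ck_open (Suc k) S f \<longleftrightarrow>
     (\<forall>x\<in>S. f differentiable (at x)) \<and>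
     (\<forall>v. Ck_open k S (\<lambda>x. frechet_derivative f (at x) v))"

text \<open>A map on an arbitrary subset \<open>S\<close> of a Euclidean space (in particular on a submanifold)
  is \<open>C\<^sup>k\<close> if near each point of \<open>S\<close> it is the restriction of a \<open>C\<^sup>k\<close> map defined on an open
  set of the ambient space. Values of \<open>f\<close> outside \<open>S\<close> are irrelevant.\<close>

definition Ck_on :: "nat \<Rightarrow> 'a::euclidean_space set \<Rightarrow> ('a \<Rightarrow> 'b::euclidean_space) \<Rightarrow> bool" where
  "Ck_on k S f \<longleftrightarrow>
     (\<forall>p\<in>S. \<exists>U F. open U \<and> p \<in> U \<and> Ck_open k U F \<and> (\<forall>x\<in>U \<inter> S. F x = f x))"

lemma Ck_on_open_iff:
  assumes "open S"
  shows "Ck_on k S f \<longleftrightarrow> Ck_open k S f"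
proof
  assume "Ck_open k S f"
  with assms show "Ck_on k S f"
    unfolding Ck_on_def by blast
next
  assume "Ck_on k S f"
  then show "Ck_open k S f"
  proof (induction k arbitrary: f)
    case 0
    have "isCont f p" if p: "p \<in> S" for p
    proof -
      obtain U F where U: "open U" "p \<in> U" "continuous_on U F" "\<forall>x\<in>U \<inter> S. F x = f x"
        using 0 p unfolding Ck_on_def by auto
      have "continuous_on (U \<inter> S) f"
        using continuous_on_subset[OF U(3), of "U \<inter> S"] U(4)
        by (metis continuous_on_cong inf_le1)
      then show ?thesis
        using U assms p by (simp add: continuous_on_eq_continuous_at open_Int)
    qed
    then show ?case
      by (simp add: continuous_at_imp_continuous_on)
  next
    case (Suc k)
    have deriv: "(f has_derivative frechet_derivative F (at x)) (at x)"
      if "open U" "Ck_open (Suc k) U F" "\<forall>x\<in>U \<inter> S. F x = f x" "x \<in> U \<inter> S" for U F x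
    proof (rule has_derivative_transform_within_open)
      show "(F has_derivative frechet_derivative F (at x)) (at x)"
        using that by (simp add: frechet_derivative_works[symmetric])
      show "open (U \<inter> S)" using that assms by auto
    qed (use that in auto)
    have "f differentiable (at x)" if "x \<in> S" for x
      using Suc.prems that deriv unfolding Ck_on_def
      by (meson IntI differentiableI)
    moreover have "Ck_open k S (\<lambda>x. frechet_derivative f (at x) v)" for v
    proof (rule Suc.IH)
      show "Ck_on k S (\<lambda>x. frechet_derivative f (at x) v)"
        unfolding Ck_on_def
      proof
        fix p assume "p \<in> S"
        then obtain U F where U: "open U" "p \<in> U" "Ck_open (Suc k) U F"
            "\<forall>x\<in>U \<inter> S. F x = f x"
          using Suc.prems unfolding Ck_on_def by blast
        have "frechet_derivative F (at x) v = frechet_derivative f (at x) v"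
          if "x \<in> U \<inter> S" for x
          using frechet_derivative_at[OF deriv[OF U(1,3,4) that]] by simp
        with U show "\<exists>U F. open U \<and> p \<in> U \<and> Ck_open k U F \<and>
            (\<forall>x\<in>U \<inter> S. F x = frechet_derivative f (at x) v)"
          by (intro exI[of _ U] exI[of _ "\<lambda>x. frechet_derivative F (at x) v"]) auto
      qed
    qed
    ultimately show ?case by simp
  qed
qed

definition Ck_diffeo :: "nat \<Rightarrow> 'a::euclidean_space set \<Rightarrow> 'b::euclidean_space set \<Rightarrow> ('a \<Rightarrow> 'b) \<Rightarrow> bool" where
  "Ck_diffeo k S T f \<longleftrightarrow> bij_betw f S T \<and> Ck_on k S f \<and> Ck_on k T (inv_into S f)"

text \<open>The form \<open>dx \<and> dy\<close> evaluated on a pair of vectors.\<close>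

definition dxdy :: "real \<times> real \<Rightarrow> real \<times> real \<Rightarrow> real" where
  "dxdy u v = fst u * snd v - snd u * fst v"

definition Ck_symplectomorphism :: "nat \<Rightarrow> (real \<times> real \<Rightarrow> real \<times> real) \<Rightarrow> bool" where
  "Ck_symplectomorphism k \<phi> \<longleftrightarrow>
     Ck_diffeo k UNIV UNIV \<phi> \<and>
     (\<forall>p u v. dxdy (frechet_derivative \<phi> (at p) u) (frechet_derivative \<phi> (at p) v) = dxdy u v)"

abbreviation S1 :: "(real \<times> real) set" where
  "S1 \<equiv> sphere 0 1"

definition polar :: "real \<Rightarrow> real \<Rightarrow> real \<times> real" where
  "polar r \<theta> = (r * cos \<theta>, r * sin \<theta>)"

text \<open>The image of the positive unit tangent vector at each point of the circle is a positive
  tangent vector, i.e. the outward normal \<open>f p\<close> followed by that image is a positively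
  oriented basis of the plane.\<close>

definition orientation_preserving_S1 :: "(real \<times> real \<Rightarrow> real \<times> real) \<Rightarrow> bool" where
  "orientation_preserving_S1 f \<longleftrightarrow>
     (\<forall>\<theta>. dxdy (f (polar 1 \<theta>)) (vector_derivative (\<lambda>t. f (polar 1 t)) (at \<theta>)) > 0)"

text \<open>On a neighbourhood of the circle, \<open>\<phi>(r,\<theta>) = (g(r,\<theta>), f(\<theta>))\<close> in polar coordinates;
  the angular coordinate of \<open>f (polar 1 \<theta>)\<close> is any \<open>\<alpha>\<close> with \<open>f (polar 1 \<theta>) = polar 1 \<alpha>\<close>.\<close>

definition angular_form_near_S1 ::
    "(real \<times> real \<Rightarrow> real \<times> real) \<Rightarrow> (real \<times> real \<Rightarrow> real \<times> real) \<Rightarrow> bool" where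
  "angular_form_near_S1 f \<phi> \<longleftrightarrow>
     (\<exists>U g. open U \<and> S1 \<subseteq> U \<and>
        (\<forall>r>0. \<forall>\<theta> \<alpha>. polar r \<theta> \<in> U \<longrightarrow> f (polar 1 \<theta>) = polar 1 \<alpha> \<longrightarrow>
           g r \<theta> > 0 \<and> \<phi> (polar r \<theta>) = polar (g r \<theta>) \<alpha>))"

end

theory Submission
  imports Defs
begin

text \<open>Lift \<open>f\<close> to \<open>F : \<real> \<rightarrow> \<real>\<close> with \<open>F(\<theta> + 2 \<pi>) = F(\<theta>) + 2 \<pi>\<close> and \<open>F' > 0\<close>, and use the symplectic
  coordinates \<open>(I, \<theta>)\<close> with \<open>I = r\<^sup>2/2\<close>. Near the circle \<open>I = 1/2\<close> the map
  \<open>(I, \<theta>) \<mapsto> (1/2 + (I - 1/2)/F'(\<theta>), F(\<theta>))\<close> is symplectic, with generating function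
  \<open>J \<theta> + (J - 1/2) u(\<theta>)\<close> where \<open>u = F - id\<close>. Replacing the factor \<open>J - 1/2\<close> by a
  compactly supported \<open>H(J)\<close> that agrees with it near \<open>1/2\<close>, one gets a global symplectomorphism, equal to the identity away from
  the circle, provided \<open>1 + H'(J) u'(\<theta>) > 0\<close>. Since \<open>u' > -1\<close> is bounded, this holds as soon as
  \<open>-\<epsilon> \<le> H' \<le> 1\<close> for small \<open>\<epsilon>\<close>. As the generating function is only differentiated once in \<open>\<theta>\<close>,
  exactly one derivative is lost.\<close>

section \<open>Calculus of \<open>C\<^sup>k\<close> maps\<close>

lemma Ck_open_subset: "Ck_open k S f \<Longrightarrow> T \<subseteq> S \<Longrightarrow> Ck_open k T f"
  by (induction k arbitrary: f) (auto intro: continuous_on_subset)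

text \<open>Regularity on an open set is a local matter, by the agreement of \<open>Ck_on\<close>
  and \<open>Ck_open\<close> there. This handles maps given by different formulas near different
  points.\<close>

lemma Ck_open_local:
  assumes "open S"
    and "\<And>p. p \<in> S \<Longrightarrow> \<exists>U F. open U \<and> p \<in> U \<and> Ck_open k U F \<and> (\<forall>x\<in>U \<inter> S. F x = f x)"
  shows "Ck_open k S f"
  using assms by (simp flip: Ck_on_open_iff) (simp add: Ck_on_def)

lemma Ck_open_cong:
  assumes "open S" "Ck_open k S f" "\<And>x. x \<in> S \<Longrightarrow> g x = f x"
  shows "Ck_open k S g"
  using assms by (intro Ck_open_local) auto

text \<open>Uniqueness of the derivative lets any explicit formula \<open>D\<close> stand in for
  \<open>frechet_derivative\<close>.\<close>

lemma Ck_open_SucI: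
  assumes "open S" "\<And>x. x \<in> S \<Longrightarrow> (f has_derivative D x) (at x)"
    and "\<And>v. Ck_open k S (\<lambda>x. D x v)"
  shows "Ck_open (Suc k) S f"
proof -
  have "frechet_derivative f (at x) = D x" if "x \<in> S" for x
    using frechet_derivative_at[OF assms(2)[OF that]] by simp
  then have "Ck_open k S (\<lambda>x. frechet_derivative f (at x) v)" for v
    by (intro Ck_open_cong[OF assms(1) assms(3)[of v]]) simp
  then show ?thesis
    using assms(2) by (auto simp: differentiable_def)
qed

lemma Ck_open_Suc_derivative:
  assumes "Ck_open (Suc k) S f" "x \<in> S"
  shows "(f has_derivative frechet_derivative f (at x)) (at x)"
  using assms by (simp add: frechet_derivative_works[symmetric])

lemma Ck_open_frechet: "Ck_open (Suc k) S f \<Longrightarrow> Ck_open k S (\<lambda>x. frechet_derivative f (at x) v)"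
  by simp

lemma Ck_open_SucD: "Ck_open (Suc k) S f \<Longrightarrow> Ck_open k S f"
proof (induction k arbitrary: f)
  case 0
  then show ?case
    by (auto intro!: continuous_at_imp_continuous_on differentiable_imp_continuous_within)
next
  case (Suc k)
  then show ?case by (metis Ck_open.simps(2))
qed

lemma Ck_open_mono: "Ck_open k S f \<Longrightarrow> j \<le> k \<Longrightarrow> Ck_open j S f"
  by (induction k) (auto simp: le_Suc_eq intro: Ck_open_SucD simp del: Ck_open.simps)

lemma Ck_open_continuous_on: "Ck_open k S f \<Longrightarrow> continuous_on S f"
  using Ck_open_mono[of k S f 0] by simp

lemma Ck_open_const: "open S \<Longrightarrow> Ck_open k S (\<lambda>x. c)"
  by (induction k arbitrary: c) (auto simp del: Ck_open.simps(2) intro!: Ck_open_SucI[where D = "\<lambda>x v. 0"])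

lemma Ck_open_linear:
  assumes "open S" "bounded_linear f"
  shows "Ck_open k S f"
proof (cases k)
  case 0
  with assms show ?thesis by (simp add: linear_continuous_on)
next
  case (Suc j)
  show ?thesis
    unfolding Suc
    by (rule Ck_open_SucI[OF assms(1), where D = "\<lambda>x. f"])
       (use assms in \<open>auto intro!: bounded_linear_imp_has_derivative Ck_open_const\<close>)
qed

lemma Ck_open_ident: "open S \<Longrightarrow> Ck_open k S (\<lambda>x. x)"
  by (rule Ck_open_linear) auto

lemma Ck_open_linear_comp:
  assumes "bounded_linear h" "open S" "Ck_open k S f"
  shows "Ck_open k S (\<lambda>x. h (f x))"
  using assms(3)
proof (induction k arbitrary: f)
  case 0
  then show ?case using assms by (auto intro: bounded_linear.continuous_on)
next
  case (Suc k)
  show ?case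
    by (rule Ck_open_SucI[OF assms(2), where D = "\<lambda>x v. h (frechet_derivative f (at x) v)"])
       (use Suc in \<open>auto intro!: bounded_linear.has_derivative[OF assms(1)] Ck_open_Suc_derivative\<close>)
qed

lemma Ck_open_add:
  assumes "open S" "Ck_open k S f" "Ck_open k S g"
  shows "Ck_open k S (\<lambda>x. f x + g x)"
  using assms(2,3)
proof (induction k arbitrary: f g)
  case 0
  then show ?case by (auto intro: continuous_intros)
next
  case (Suc k)
  show ?case
    by (rule Ck_open_SucI[OF assms(1),
          where D = "\<lambda>x v. frechet_derivative f (at x) v + frechet_derivative g (at x) v"])
       (use Suc in \<open>auto intro!: has_derivative_add Ck_open_Suc_derivative\<close>)
qed

text \<open>Product rule: each summand is again a value of \<open>pr\<close> with one factor
  differentiated, so the induction generalises over both factors.\<close>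

lemma Ck_open_bilinear:
  assumes "bounded_bilinear pr" "open S" "Ck_open k S f" "Ck_open k S g"
  shows "Ck_open k S (\<lambda>x. pr (f x) (g x))"
  using assms(3,4)
proof (induction k arbitrary: f g)
  case 0
  then show ?case using assms(1) by (auto intro: bounded_bilinear.continuous_on)
next
  case (Suc k)
  show ?case
  proof (rule Ck_open_SucI[OF assms(2)])
    fix x assume "x \<in> S"
    then show "((\<lambda>x. pr (f x) (g x)) has_derivative (\<lambda>v. pr (f x) (frechet_derivative g (at x) v) +
          pr (frechet_derivative f (at x) v) (g x))) (at x)"
      using Suc.prems by (intro bounded_bilinear.FDERIV[OF assms(1)] Ck_open_Suc_derivative)
  next
    fix v
    show "Ck_open k S (\<lambda>x. pr (f x) (frechet_derivative g (at x) v) +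
          pr (frechet_derivative f (at x) v) (g x))"
      using Suc.prems by (intro Ck_open_add assms(2) Suc.IH)
        (auto intro: Ck_open_SucD Ck_open_frechet simp del: Ck_open.simps)
  qed
qed

lemmas Ck_open_scaleR = Ck_open_bilinear[OF bounded_bilinear_scaleR]
lemmas Ck_open_mult = Ck_open_bilinear[OF bounded_bilinear_mult]

lemma Ck_open_minus:
  fixes f :: "'a::euclidean_space \<Rightarrow> 'b::euclidean_space"
  assumes "open S" "Ck_open k S f"
  shows "Ck_open k S (\<lambda>x. - f x)"
  using Ck_open_linear_comp[OF bounded_linear_minus[OF bounded_linear_ident] assms] .

lemma Ck_open_diff:
  assumes "open S" "Ck_open k S f" "Ck_open k S g"
  shows "Ck_open k S (\<lambda>x. f x - g x)"
  using Ck_open_add[OF assms(1,2) Ck_open_minus[OF assms(1,3)]] by simp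

lemma Ck_open_sum:
  assumes "open S" "finite I" "\<And>i. i \<in> I \<Longrightarrow> Ck_open k S (f i)"
  shows "Ck_open k S (\<lambda>x. \<Sum>i\<in>I. f i x)"
  using assms(2,3) by (induction I rule: finite_induct) (auto intro: Ck_open_add Ck_open_const assms(1))

text \<open>The chain rule applies the derivative of \<open>g\<close> to a vector varying with
  \<open>x\<close>, whereas \<open>Ck_open\<close> controls derivatives along fixed directions.
  Expanding that vector in \<open>Basis\<close> restores fixed directions.\<close>

lemma Ck_open_compose:
  assumes "open S" "open T" "Ck_open k S f" "Ck_open k T g" "f ` S \<subseteq> T"
  shows "Ck_open k S (\<lambda>x. g (f x))"
  using assms(3,4)
proof (induction k arbitrary: g)
  case 0
  then show ?case using assms(5) by (auto intro: continuous_on_compose2)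
next
  case (Suc k)
  have T: "f x \<in> T" if "x \<in> S" for x using assms(5) that by auto
  let ?Df = "\<lambda>x. frechet_derivative f (at x)" and ?Dg = "\<lambda>x. frechet_derivative g (at x)"
  show ?case
  proof (rule Ck_open_SucI[OF assms(1)])
    fix x assume x: "x \<in> S"
    have g: "(g has_derivative ?Dg (f x)) (at (f x))"
      using Ck_open_Suc_derivative[OF Suc.prems(2) T[OF x]] .
    have "((\<lambda>x. g (f x)) has_derivative (\<lambda>v. ?Dg (f x) (?Df x v))) (at x)"
      using has_derivative_compose[OF Ck_open_Suc_derivative[OF Suc.prems(1) x] g] .
    also have "(\<lambda>v. ?Dg (f x) (?Df x v)) = (\<lambda>v. \<Sum>i\<in>Basis. (?Df x v \<bullet> i) *\<^sub>R ?Dg (f x) i)"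
    proof
      fix v
      have lin: "linear (?Dg (f x))" using has_derivative_linear[OF g] .
      have "?Dg (f x) (?Df x v) = ?Dg (f x) (\<Sum>i\<in>Basis. (?Df x v \<bullet> i) *\<^sub>R i)"
        by (simp add: euclidean_representation)
      then show "?Dg (f x) (?Df x v) = (\<Sum>i\<in>Basis. (?Df x v \<bullet> i) *\<^sub>R ?Dg (f x) i)"
        by (simp add: linear_sum[OF lin] linear_scale[OF lin])
    qed
    finally show "((\<lambda>x. g (f x)) has_derivative (\<lambda>v. \<Sum>i\<in>Basis. (?Df x v \<bullet> i) *\<^sub>R ?Dg (f x) i)) (at x)" .
  next
    fix v
    show "Ck_open k S (\<lambda>x. \<Sum>i\<in>Basis. (?Df x v \<bullet> i) *\<^sub>R ?Dg (f x) i)"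
    proof (intro Ck_open_sum Ck_open_scaleR assms(1) finite_Basis)
      fix i :: 'b assume "i \<in> Basis"
      show "Ck_open k S (\<lambda>x. ?Df x v \<bullet> i)"
        using Suc.prems by (intro Ck_open_linear_comp[OF bounded_linear_inner_left] assms(1)) auto
      show "Ck_open k S (\<lambda>x. ?Dg (f x) i)"
        using Suc.prems by (intro Suc.IH Ck_open_SucD[OF Suc.prems(1)]) auto
    qed
  qed
qed

lemma Ck_open_Pair:
  assumes "open S" "Ck_open k S f" "Ck_open k S g"
  shows "Ck_open k S (\<lambda>x. (f x, g x))"
proof -
  have "bounded_linear (\<lambda>y::'b. (y, 0::'c))" "bounded_linear (\<lambda>y::'c. (0::'b, y))"
    by (auto intro!: bounded_linear_Pair bounded_linear_ident bounded_linear_zero)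
  from Ck_open_add[OF assms(1) Ck_open_linear_comp[OF this(1) assms(1,2)] Ck_open_linear_comp[OF this(2) assms(1,3)]]
  show ?thesis by simp
qed

lemmas Ck_open_fst = Ck_open_linear_comp[OF bounded_linear_fst]
lemmas Ck_open_snd = Ck_open_linear_comp[OF bounded_linear_snd]

section \<open>Elementary functions of one real variable\<close>

lemma Ck_open_SucI_real:
  fixes f :: "real \<Rightarrow> real"
  assumes "open S" "\<And>x. x \<in> S \<Longrightarrow> (f has_real_derivative D x) (at x)" "Ck_open k S D"
  shows "Ck_open (Suc k) S f"
  by (rule Ck_open_SucI[OF assms(1), where D = "\<lambda>x v. D x * v"])
     (use assms in \<open>auto intro: Ck_open_mult Ck_open_const simp: has_field_derivative_def\<close>)

text \<open>The derivative is a polynomial in the function itself, so the induction closes.\<close>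

lemma Ck_open_inverse_real: "Ck_open k (- {0}) (inverse :: real \<Rightarrow> real)"
proof (induction k)
  case 0
  then show ?case by (auto intro: continuous_intros)
next
  case (Suc k)
  show ?case
    by (rule Ck_open_SucI_real[where D = "\<lambda>x. - (inverse x * inverse x)"])
       (use Suc in \<open>auto intro!: Ck_open_minus Ck_open_mult derivative_eq_intros simp: power2_eq_square\<close>)
qed

lemma Ck_open_inverse:
  fixes g :: "'a::euclidean_space \<Rightarrow> real"
  assumes "open S" "Ck_open k S g" "\<And>x. x \<in> S \<Longrightarrow> g x \<noteq> 0"
  shows "Ck_open k S (\<lambda>x. inverse (g x))"
  by (rule Ck_open_compose[OF assms(1) _ assms(2) Ck_open_inverse_real]) (use assms(3) in auto)

text \<open>Each function is the derivative of the other up to sign, hence the joint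
  induction.\<close>

lemma Ck_open_sin_cos: "Ck_open k UNIV (sin :: real \<Rightarrow> real) \<and> Ck_open k UNIV (cos :: real \<Rightarrow> real)"
proof (induction k)
  case 0
  then show ?case by (auto intro: continuous_intros)
next
  case (Suc k)
  then have "Ck_open (Suc k) UNIV (sin :: real \<Rightarrow> real)" "Ck_open (Suc k) UNIV (cos :: real \<Rightarrow> real)"
    by (auto intro!: Ck_open_SucI_real Ck_open_minus DERIV_sin DERIV_cos simp del: Ck_open.simps)
  then show ?case ..
qed

lemma Ck_open_arctan: "Ck_open k UNIV (arctan :: real \<Rightarrow> real)"
proof (cases k)
  case 0
  then show ?thesis by (auto intro: continuous_intros)
next
  case (Suc j)
  have nz: "1 + x * x \<noteq> 0" for x :: real
    by (metis add_pos_nonneg zero_le_square zero_less_one less_numeral_extra(3))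
  have "Ck_open j UNIV (\<lambda>x::real. inverse (1 + x * x))"
    by (intro Ck_open_inverse Ck_open_add Ck_open_const Ck_open_mult Ck_open_ident open_UNIV nz)
  then show ?thesis
    unfolding Suc
    by (rule Ck_open_SucI_real[rotated 2]) (auto intro!: derivative_eq_intros simp: power2_eq_square)
qed

lemma Ck_open_ln: "Ck_open k {0<..} (ln :: real \<Rightarrow> real)"
proof (cases k)
  case 0
  then show ?thesis by (auto intro!: continuous_intros)
next
  case (Suc j)
  show ?thesis
    unfolding Suc
    by (rule Ck_open_SucI_real[where D = inverse])
       (auto intro: Ck_open_subset[OF Ck_open_inverse_real] DERIV_ln)
qed

lemma Ck_open_sqrt: "Ck_open k {0<..} sqrt"
proof (induction k)
  case 0
  then show ?case by (auto intro!: continuous_intros)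
next
  case (Suc k)
  have "Ck_open k {0<..} (\<lambda>x. inverse (sqrt x) * (1/2))"
    by (intro Ck_open_mult Ck_open_const Ck_open_compose[OF _ _ Suc Ck_open_inverse_real]) auto
  then show ?case
    by (rule Ck_open_SucI_real[rotated 2]) (auto intro!: derivative_eq_intros simp: divide_simps)
qed

section \<open>Jacobians of planar maps\<close>

text \<open>The determinant of the derivative. Written with \<open>dxdy\<close>, it turns the
  symplectic condition into Jacobian 1.\<close>

definition plane_jacobian :: "(real \<times> real \<Rightarrow> real \<times> real) \<Rightarrow> real \<times> real \<Rightarrow> real" where
  "plane_jacobian f p = dxdy (frechet_derivative f (at p) (1, 0)) (frechet_derivative f (at p) (0, 1))"

lemma linear_plane:
  fixes D :: "real \<times> real \<Rightarrow> 'a::real_vector"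
  assumes "linear D"
  shows "D v = fst v *\<^sub>R D (1, 0) + snd v *\<^sub>R D (0, 1)"
proof -
  have "v = fst v *\<^sub>R (1, 0) + snd v *\<^sub>R (0, 1)" by (cases v) simp
  then have "D v = D (fst v *\<^sub>R (1, 0) + snd v *\<^sub>R (0, 1))" by (rule arg_cong)
  then show ?thesis unfolding linear_add[OF assms] linear_scale[OF assms] .
qed

text \<open>Alternating bilinear forms on the plane form a one-dimensional space, so pulling back by
  \<open>D\<close> multiplies \<open>dxdy\<close> by a constant, read off on the standard
  basis.\<close>

lemma dxdy_linear:
  assumes "linear D"
  shows "dxdy (D u) (D v) = dxdy (D (1, 0)) (D (0, 1)) * dxdy u v"
proof -
  obtain a b c d where "D (1, 0) = (a, b)" "D (0, 1) = (c, d)" by fastforce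
  then show ?thesis
    by (simp add: linear_plane[OF assms, of u] linear_plane[OF assms, of v] dxdy_def algebra_simps)
qed

lemma dxdy_derivative:
  assumes "f differentiable (at p)"
  shows "dxdy (frechet_derivative f (at p) u) (frechet_derivative f (at p) v) = plane_jacobian f p * dxdy u v"
  unfolding plane_jacobian_def by (rule dxdy_linear[OF linear_frechet_derivative[OF assms]])

lemma plane_jacobian_eq:
  assumes "(f has_derivative D) (at p)"
  shows "plane_jacobian f p = dxdy (D (1, 0)) (D (0, 1))"
  unfolding plane_jacobian_def frechet_derivative_at[OF assms, symmetric] ..

lemma plane_jacobian_ident: "plane_jacobian (\<lambda>x. x) p = 1"
  by (simp add: plane_jacobian_eq[OF has_derivative_ident] dxdy_def)

lemma plane_jacobian_compose:
  assumes "f differentiable (at p)" "g differentiable (at (f p))"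
  shows "plane_jacobian (\<lambda>x. g (f x)) p = plane_jacobian g (f p) * plane_jacobian f p"
proof -
  have "((\<lambda>x. g (f x)) has_derivative
      (\<lambda>v. frechet_derivative g (at (f p)) (frechet_derivative f (at p) v))) (at p)"
    by (rule has_derivative_compose) (use assms in \<open>simp_all add: frechet_derivative_works[symmetric]\<close>)
  from plane_jacobian_eq[OF this] show ?thesis
    unfolding dxdy_derivative[OF assms(2)] plane_jacobian_def[of f] .
qed

lemma plane_jacobian_cong:
  assumes "open U" "p \<in> U" "\<And>x. x \<in> U \<Longrightarrow> f x = g x" "f differentiable (at p)"
  shows "plane_jacobian g p = plane_jacobian f p"
proof -
  have "(f has_derivative frechet_derivative f (at p)) (at p)"
    using assms(4) by (simp add: frechet_derivative_works)
  then have "(g has_derivative frechet_derivative f (at p)) (at p)"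
    by (rule has_derivative_transform_within_open[OF _ assms(1-3)])
  from plane_jacobian_eq[OF this] show ?thesis by (simp add: plane_jacobian_def)
qed

lemma Ck_open_differentiable: "Ck_open k S f \<Longrightarrow> k > 0 \<Longrightarrow> x \<in> S \<Longrightarrow> f differentiable (at x)"
  by (cases k) auto

text \<open>Cramer's rule expresses the derivative of \<open>G = F\<^sup>-\<^sup>1\<close> through \<open>DF \<circ> G\<close>, so each degree of
  regularity of \<open>G\<close> yields the next one.\<close>

lemma Ck_open_inverse_map:
  fixes F G :: "real \<times> real \<Rightarrow> real \<times> real"
  assumes F: "Ck_open k UNIV F" "k > 0"
    and inv: "\<And>x. G (F x) = x" "\<And>y. F (G y) = y"
    and jac: "\<And>x. plane_jacobian F x \<noteq> 0"
  shows "Ck_open k UNIV G"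
proof -
  \<comment> \<open>Continuity of the inverse comes from invariance of domain.\<close>
  have "continuous_on (range F) G"
    by (rule continuous_on_inverse_open[OF _ Ck_open_continuous_on[OF F(1)]]) (auto simp: inv)
  moreover have "range F = UNIV" using inv(2) by (rule surjI)
  ultimately have contG: "continuous_on UNIV G" by simp
  define D where "D x = frechet_derivative F (at x)" for x
  define E where "E y w = (dxdy w (D (G y) (0, 1)) * inverse (plane_jacobian F (G y)),
      dxdy (D (G y) (1, 0)) w * inverse (plane_jacobian F (G y)))" for y w
  have deriv: "(G has_derivative E y) (at y)" for y
  proof (rule has_derivative_inverse_basic[where f = F and f' = "D (G y)" and T = UNIV])
    have diff: "F differentiable (at (G y))" using Ck_open_differentiable[OF F] by simp
    then show "(F has_derivative D (G y)) (at (G y))"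
      by (simp add: D_def frechet_derivative_works)
    show "bounded_linear (E y)"
      unfolding E_def dxdy_def
      by (intro bounded_linear_Pair bounded_linear_mult_const bounded_linear_sub bounded_linear_const_mult
          bounded_linear_fst bounded_linear_snd)
    show "E y \<circ> D (G y) = id"
    proof
      fix v
      have lin: "linear (D (G y))" unfolding D_def by (rule linear_frechet_derivative[OF diff])
      \<comment> \<open>Pairing \<open>D (G y) v\<close> with the two columns of the derivative
        gives the Jacobian times the coordinates of \<open>v\<close>; the inverse Jacobian in
        \<open>E\<close> cancels it.\<close>
      show "(E y \<circ> D (G y)) v = id v"
        using jac[of "G y"]
        unfolding E_def D_def o_apply dxdy_derivative[OF diff] id_apply
        by (simp add: dxdy_def prod_eq_iff)
    qed
    show "continuous (at y) G" using continuous_on_eq_continuous_at[OF open_UNIV] contG by blast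
  qed (auto simp: inv)
  have "Ck_open j UNIV G" if "j \<le> k" for j
    using that
  proof (induction j)
    case 0
    then show ?case using contG by simp
  next
    case (Suc j)
    then have G: "Ck_open j UNIV G" by simp
    have FS: "Ck_open (Suc j) UNIV F" using Ck_open_mono[OF F(1) Suc.prems] .
    have D: "Ck_open j UNIV (\<lambda>y. D (G y) v)" for v
      unfolding D_def by (rule Ck_open_compose[OF _ _ G Ck_open_frechet[OF FS]]) auto
    have J: "Ck_open j UNIV (\<lambda>y. inverse (plane_jacobian F (G y)))"
    proof (rule Ck_open_inverse[OF open_UNIV _ jac])
      show "Ck_open j UNIV (\<lambda>y. plane_jacobian F (G y))"
        unfolding plane_jacobian_def dxdy_def D_def[symmetric]
        by (intro Ck_open_diff Ck_open_mult Ck_open_fst Ck_open_snd D open_UNIV)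
    qed
    show ?case
    proof (rule Ck_open_SucI[OF _ deriv])
      show "Ck_open j UNIV (\<lambda>y. E y v)" for v
        unfolding E_def dxdy_def
        by (intro Ck_open_Pair Ck_open_mult Ck_open_diff Ck_open_const Ck_open_fst Ck_open_snd D J open_UNIV)
    qed auto
  qed
  then show ?thesis by simp
qed

section \<open>A cutoff with slope between \<open>-\<epsilon>\<close> and \<open>1\<close>\<close>

text \<open>Away from 0 the function is a power or zero. At 0 its difference quotient is exactly
  \<open>max 0 h ^ Suc m\<close>, which tends to 0 because the exponent is positive.\<close>

lemma has_real_derivative_max_power:
  "((\<lambda>x::real. max 0 x ^ Suc (Suc m)) has_real_derivative (real (Suc (Suc m)) * max 0 x ^ Suc m)) (at x)"
proof -
  consider "x > 0" | "x < 0" | "x = 0" by linarith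
  then show ?thesis
  proof cases
    case 1
    have "((\<lambda>x::real. x ^ Suc (Suc m)) has_real_derivative (real (Suc (Suc m)) * x ^ Suc m)) (at x)"
      using DERIV_pow[of "Suc (Suc m)" x] by simp
    then have "((\<lambda>x::real. max 0 x ^ Suc (Suc m)) has_real_derivative (real (Suc (Suc m)) * x ^ Suc m)) (at x)"
      by (rule has_field_derivative_transform_within_open[where S = "{0<..}"]) (use 1 in auto)
    with 1 show ?thesis by simp
  next
    case 2
    have "((\<lambda>x::real. 0) has_real_derivative 0) (at x)" by simp
    then have "((\<lambda>x::real. max 0 x ^ Suc (Suc m)) has_real_derivative 0) (at x)"
      by (rule has_field_derivative_transform_within_open[where S = "{..<0}"]) (use 2 in auto)
    with 2 show ?thesis by simp
  next
    case 3
    have "((\<lambda>h::real. max 0 h ^ Suc m) \<longlongrightarrow> max 0 0 ^ Suc m) (at 0)"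
      by (intro tendsto_intros)
    moreover have "\<forall>\<^sub>F h in at (0::real). max 0 h ^ Suc m = (max 0 (0 + h) ^ Suc (Suc m) - max 0 0 ^ Suc (Suc m)) / h"
      by (rule eventually_at_filter[THEN iffD2], rule always_eventually) (auto simp: max_def)
    ultimately have "((\<lambda>h::real. (max 0 (0 + h) ^ Suc (Suc m) - max 0 0 ^ Suc (Suc m)) / h) \<longlongrightarrow> 0) (at 0)"
      using filterlim_cong[THEN iffD1] by fastforce
    then show ?thesis unfolding 3 DERIV_def by simp
  qed
qed

text \<open>Each differentiation lowers the exponent by one until the continuous
  \<open>max 0 x\<close> remains. These truncated powers are the building blocks of a cutoff of
  finite regularity.\<close>

lemma Ck_open_max_power: "Ck_open m UNIV (\<lambda>x::real. max 0 x ^ Suc m)"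
proof (induction m)
  case 0
  then show ?case by (auto intro!: continuous_intros)
next
  case (Suc m)
  show ?case
    by (rule Ck_open_SucI_real[OF _ has_real_derivative_max_power])
       (intro Ck_open_mult Ck_open_const Suc open_UNIV)+
qed

text \<open>The step is p(1 - x) / (p(x) + p(1 - x)) for a truncated power p, the usual
  partition-of-unity quotient.\<close>

lemma smooth_step:
  obtains G G' :: "real \<Rightarrow> real" and M :: real
  where "\<And>x. x \<le> 0 \<Longrightarrow> G x = 1" "\<And>x. x \<ge> 1 \<Longrightarrow> G x = 0" "\<And>x. 0 \<le> G x \<and> G x \<le> 1"
    "\<And>x. (G has_real_derivative G' x) (at x)" "\<And>x. - M \<le> G' x \<and> G' x \<le> 0" "Ck_open k UNIV G'"
proof -
  \<comment> \<open>The exponent is \<open>k + 2\<close> so that \<open>p'\<close>, of exponent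
    \<open>k + 1\<close>, is still C^k.\<close>
  define p p' :: "real \<Rightarrow> real"
    where "p x = max 0 x ^ Suc (Suc k)" and "p' x = real (Suc (Suc k)) * max 0 x ^ Suc k" for x
  have dp: "(p has_real_derivative p' x) (at x)" for x
    using has_real_derivative_max_power[of k x] unfolding p_def p'_def .
  have p0: "p x \<ge> 0" "p' x \<ge> 0" for x by (auto simp: p_def p'_def)
  have ppos: "p x > 0" if "x > 0" for x using that by (auto simp: p_def)
  have pz: "p x = 0" "p' x = 0" if "x \<le> 0" for x using that by (auto simp: p_def p'_def)
  \<comment> \<open>\<open>Q\<close> never vanishes because \<open>x\<close> and
    \<open>1 - x\<close> are not both nonpositive.\<close>
  define Q where "Q x = p x + p (1 - x)" for x
  have Q: "Q x > 0" for x
    using ppos[of x] ppos[of "1 - x"] p0(1)[of x] p0(1)[of "1 - x"] unfolding Q_def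
    by (cases "x > 0") auto
  define G where "G x = p (1 - x) / Q x" for x
  define G' where "G' x = - (p' (1 - x) * p x + p (1 - x) * p' x) * (inverse (Q x) * inverse (Q x))" for x
  have dG: "(G has_real_derivative G' x) (at x)" for x
  proof -
    have d1: "((\<lambda>x. p (1 - x)) has_real_derivative - p' (1 - x)) (at x)"
      by (rule DERIV_cong[OF DERIV_chain2[OF dp]]) (auto intro!: derivative_eq_intros)
    show ?thesis
      unfolding G_def Q_def
      by (rule DERIV_cong[OF DERIV_divide[OF d1 DERIV_add[OF dp d1]]])
         (use Q[of x] in \<open>auto simp: G'_def Q_def divide_simps, simp add: algebra_simps\<close>)
  qed
  have Cp': "Ck_open k UNIV p'"
    unfolding p'_def by (intro Ck_open_mult Ck_open_const Ck_open_max_power open_UNIV)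
  have Cp: "Ck_open k UNIV p"
    using Ck_open_SucD[OF Ck_open_max_power[of "Suc k"]] unfolding p_def .
  have C1: "Ck_open k UNIV (\<lambda>x. h (1 - x))" if "Ck_open k UNIV h" for h :: "real \<Rightarrow> real"
    by (intro Ck_open_compose[OF _ _ _ that] Ck_open_diff Ck_open_const Ck_open_ident open_UNIV) auto
  have CQ: "Ck_open k UNIV (\<lambda>x. inverse (Q x))"
  proof (rule Ck_open_inverse)
    show "Ck_open k UNIV Q" unfolding Q_def by (intro Ck_open_add Cp C1 open_UNIV)
    show "Q x \<noteq> 0" for x using Q[of x] by simp
  qed simp
  have CG': "Ck_open k UNIV G'"
    unfolding G'_def by (intro Ck_open_mult Ck_open_minus Ck_open_add Cp Cp' C1 CQ open_UNIV)
  have neg: "G' x \<le> 0" for x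
  proof -
    have "0 \<le> p' (1 - x) * p x" "0 \<le> p (1 - x) * p' x" by (simp_all add: p0)
    then show ?thesis unfolding G'_def using Q[of x] by (intro mult_nonpos_nonneg) auto
  qed
  have "compact (G' ` {0..1})"
    by (rule compact_continuous_image[OF continuous_on_subset[OF Ck_open_continuous_on[OF CG']]]) auto
  then obtain M where M: "\<And>x. x \<in> {0..1} \<Longrightarrow> \<bar>G' x\<bar> \<le> M"
    using compact_imp_bounded bounded_iff by (metis image_eqI real_norm_def)
  \<comment> \<open>Compactness bounds \<open>G'\<close> on the unit interval only. Outside it
    \<open>x\<close> or \<open>1 - x\<close> is negative, and both terms of the numerator
    vanish.\<close>
  have "- M \<le> G' x" for x
  proof (cases "x \<in> {0..1}")
    case True
    with M[OF True] show ?thesis by linarith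
  next
    case False
    then have "G' x = 0" unfolding G'_def using pz[of x] pz[of "1 - x"] by auto
    moreover have "M \<ge> 0" using M[of 0] by simp
    ultimately show ?thesis by simp
  qed
  moreover have "G x = 1" if "x \<le> 0" for x
    using ppos[of "1 - x"] pz(1)[OF that] that by (simp add: G_def Q_def)
  ultimately show ?thesis
    using p0 Q by (intro that[of G G' M] dG CG') (auto simp: G_def Q_def pz neg divide_simps)
qed

text \<open>The slope of a compactly supported function must become negative somewhere. Letting the cutoff
  vary on a logarithmic scale, which is what \<open>ln\<close> achieves below, keeps it above \<open>-\<epsilon>\<close>.\<close>

lemma action_profile:
  fixes \<epsilon> :: real
  assumes "\<epsilon> > 0"
  obtains H H' :: "real \<Rightarrow> real" and a :: real
  where "0 < a" "a < 1/4"
    "\<And>x. \<bar>x - 1/2\<bar> \<le> a \<Longrightarrow> H x = x - 1/2 \<and> H' x = 1"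
    "\<And>x. \<bar>x - 1/2\<bar> \<ge> 1/4 \<Longrightarrow> H x = 0 \<and> H' x = 0"
    "\<And>x. (H has_real_derivative H' x) (at x)" "\<And>x. - \<epsilon> \<le> H' x \<and> H' x \<le> 1" "Ck_open k UNIV H'"
proof -
  obtain G G' :: "real \<Rightarrow> real" and M :: real
    where G: "\<And>x. x \<le> 0 \<Longrightarrow> G x = 1" "\<And>x. x \<ge> 1 \<Longrightarrow> G x = 0" "\<And>x. 0 \<le> G x \<and> G x \<le> 1"
      "\<And>x. (G has_real_derivative G' x) (at x)" "\<And>x. - M \<le> G' x \<and> G' x \<le> 0" "Ck_open k UNIV G'"
    using smooth_step[of k] by blast
  have "M \<ge> 0" using G(5)[of 0] by linarith
  \<comment> \<open>The slope of \<open>h\<close> will fall below the value of \<open>G\<close> by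
    at most \<open>2 * c * M\<close>. Adding 1 to \<open>M\<close> keeps the denominator positive
    when \<open>M = 0\<close>.\<close>
  define c where "c = \<epsilon> / (2 * (M + 1))"
  have c: "c > 0" "2 * c * M \<le> \<epsilon>"
    using assms \<open>M \<ge> 0\<close> by (auto simp: c_def divide_simps)
  \<comment> \<open>So small that \<open>R s\<close> is at least \<open>exp (1 / c)\<close> once
    \<bar>s\<bar> reaches 1/4, so that the cutoff is complete there.\<close>
  define a where "a = exp (- 1 / c) / 8"
  have ea: "exp (- 1 / c) < 1" using c by simp
  have a: "0 < a" "a < 1/4" using ea unfolding a_def by (simp, linarith)
  have a2: "2 * a\<^sup>2 * exp (1 / c) \<le> 1/16"
  proof -
    have "exp (- 1 / c) * exp (1 / c) = 1" by (simp flip: exp_add)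
    then have "2 * a\<^sup>2 * exp (1 / c) = exp (- 1 / c) / 32"
      unfolding a_def power2_eq_square by (simp add: field_simps)
    with ea show ?thesis by linarith
  qed
  \<comment> \<open>\<open>R\<close> equals 1 at distance \<open>a\<close> from 0 and stays smooth
    and positive at 0, where the logarithm of \<bar>s\<bar> itself would be singular.\<close>
  define R where "R s = (s\<^sup>2 + a\<^sup>2) * inverse (2 * a\<^sup>2)" for s
  define \<tau> where "\<tau> s = c * ln (R s)" for s
  define \<tau>' where "\<tau>' s = c * (2 * s) * inverse (s\<^sup>2 + a\<^sup>2)" for s
  have sa: "s\<^sup>2 + a\<^sup>2 > 0" for s using a by (simp add: add_nonneg_pos)
  have R: "R s > 0" for s unfolding R_def using sa[of s] a by auto
  have d\<tau>: "(\<tau> has_real_derivative \<tau>' s) (at s)" for s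
  proof -
    have dR: "(R has_real_derivative 2 * s * inverse (2 * a\<^sup>2)) (at s)"
      unfolding R_def by (rule derivative_eq_intros refl)+ simp
    have eq: "c * (inverse (R s) * (2 * s * inverse (2 * a\<^sup>2))) = \<tau>' s"
      unfolding R_def \<tau>'_def using a by (simp add: field_simps)
    show ?thesis
      unfolding \<tau>_def by (rule DERIV_cong[OF DERIV_cmult[OF DERIV_chain2[OF DERIV_ln[OF R] dR]] eq])
  qed
  have \<tau>0: "\<tau> s \<le> 0" if "\<bar>s\<bar> \<le> a" for s
  proof -
    have "s\<^sup>2 \<le> a\<^sup>2" using that a by (simp flip: abs_le_square_iff)
    then have "R s \<le> 1" unfolding R_def using a by (simp add: divide_simps flip: divide_inverse)
    then have "ln (R s) \<le> 0" using R[of s] by simp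
    then show ?thesis unfolding \<tau>_def using c by (simp add: mult_nonneg_nonpos)
  qed
  have \<tau>1: "\<tau> s \<ge> 1" if "\<bar>s\<bar> \<ge> 1/4" for s
  proof -
    have "(1/4)\<^sup>2 \<le> s\<^sup>2" using that by (metis abs_le_square_iff abs_of_nonneg zero_le_divide_1_iff zero_le_numeral)
    then have "2 * a\<^sup>2 * exp (1 / c) \<le> s\<^sup>2 + a\<^sup>2"
    proof -
      have "(1/4 :: real)\<^sup>2 = 1/16" by (simp add: power2_eq_square)
      then show ?thesis using \<open>(1/4)\<^sup>2 \<le> s\<^sup>2\<close> a2 zero_le_power2[of a] by linarith
    qed
    then have "exp (1 / c) \<le> R s" unfolding R_def using a by (simp add: divide_simps mult.commute flip: divide_inverse)
    then have "1 / c \<le> ln (R s)" using R[of s] by (simp add: ln_ge_iff)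
    then show ?thesis unfolding \<tau>_def using c by (simp add: divide_simps mult.commute)
  qed
  define h where "h s = s * G (\<tau> s)" for s
  define h' where "h' s = G (\<tau> s) + s * (G' (\<tau> s) * \<tau>' s)" for s
  have dh: "(h has_real_derivative h' s) (at s)" for s
    unfolding h_def
    by (rule DERIV_cong[OF DERIV_mult[OF DERIV_ident DERIV_chain2[OF G(4) d\<tau>]]]) (simp add: h'_def)
  have bnd: "- \<epsilon> \<le> h' s \<and> h' s \<le> 1" for s
  proof -
    \<comment> \<open>\<open>t\<close> is the derivative of \<open>\<tau>\<close> with respect to
      the logarithm of \<open>s\<close>; it lies between 0 and \<open>2 * c\<close> however small
      \<open>a\<close> is.\<close>
    define t where "t = s * \<tau>' s"
    have "t = 2 * c * (s\<^sup>2 / (s\<^sup>2 + a\<^sup>2))"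
      unfolding t_def \<tau>'_def by (simp add: power2_eq_square divide_inverse)
    moreover have "s\<^sup>2 / (s\<^sup>2 + a\<^sup>2) \<le> 1" "0 \<le> s\<^sup>2 / (s\<^sup>2 + a\<^sup>2)" using sa[of s] by simp_all
    ultimately have t: "0 \<le> t" "t \<le> 2 * c"
      using c(1) mult_left_mono[of "s\<^sup>2 / (s\<^sup>2 + a\<^sup>2)" 1 "2 * c"] by simp_all
    have "G' (\<tau> s) * t \<le> 0" using G(5)[of "\<tau> s"] t(1) by (intro mult_nonpos_nonneg) auto
    moreover have "- (2 * c * M) \<le> G' (\<tau> s) * t"
    proof -
      have "- (G' (\<tau> s)) * t \<le> M * (2 * c)"
        using G(5)[of "\<tau> s"] t \<open>M \<ge> 0\<close> by (intro mult_mono) linarith+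
      then show ?thesis by (simp add: algebra_simps)
    qed
    moreover have "h' s = G (\<tau> s) + G' (\<tau> s) * t" unfolding h'_def t_def by (simp add: algebra_simps)
    ultimately show ?thesis using G(3)[of "\<tau> s"] c(2) by linarith
  qed
  have CG: "Ck_open k UNIV G"
    using Ck_open_SucD[OF Ck_open_SucI_real[OF open_UNIV G(4) G(6)]] .
  have Csq: "Ck_open k UNIV (\<lambda>s. s\<^sup>2 + a\<^sup>2)"
    unfolding power2_eq_square by (intro Ck_open_add Ck_open_mult Ck_open_const Ck_open_ident open_UNIV)
  have CR: "Ck_open k UNIV R"
    unfolding R_def by (intro Ck_open_mult Csq Ck_open_const open_UNIV)
  have "range R \<subseteq> {0<..}" using R by blast
  from Ck_open_compose[OF open_UNIV open_greaterThan CR Ck_open_ln this] have C\<tau>: "Ck_open k UNIV \<tau>"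
    unfolding \<tau>_def by (intro Ck_open_mult Ck_open_const open_UNIV)
  have Cinv: "Ck_open k UNIV (\<lambda>s. inverse (s\<^sup>2 + a\<^sup>2))"
    by (rule Ck_open_inverse[OF open_UNIV Csq less_imp_neq[OF sa, THEN not_sym]])
  have C\<tau>': "Ck_open k UNIV \<tau>'"
    unfolding \<tau>'_def by (intro Ck_open_mult Ck_open_const Ck_open_ident Cinv open_UNIV)
  have CGt: "Ck_open k UNIV (\<lambda>s. G (\<tau> s))" "Ck_open k UNIV (\<lambda>s. G' (\<tau> s))"
    by (rule Ck_open_compose[OF open_UNIV open_UNIV C\<tau> CG subset_UNIV]
        Ck_open_compose[OF open_UNIV open_UNIV C\<tau> G(6) subset_UNIV])+
  have Ch': "Ck_open k UNIV h'"
    unfolding h'_def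
    by (intro Ck_open_add Ck_open_mult Ck_open_ident C\<tau>' open_UNIV CGt)
  have small: "h s = s \<and> h' s = 1" if "\<bar>s\<bar> \<le> a" for s
  proof -
    \<comment> \<open>\<open>G\<close> has its maximum 1 here, so a negative derivative would give
      larger values just to the left. This covers the endpoint 0 as well.\<close>
    have "G' x = 0" if "x \<le> 0" for x
    proof (rule ccontr)
      assume "G' x \<noteq> 0"
      then have "G' x < 0" using G(5)[of x] by linarith
      from DERIV_neg_dec_left[OF G(4) this] obtain d where "d > 0" "\<And>h. 0 < h \<Longrightarrow> h < d \<Longrightarrow> G x < G (x - h)"
        by blast
      from this(2)[of "d/2"] this(1) G(3)[of "x - d/2"] G(1)[OF that] show False by simp
    qed
    with G(1) \<tau>0[OF that] show ?thesis by (simp add: h_def h'_def)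
  qed
  have large: "h s = 0 \<and> h' s = 0" if "\<bar>s\<bar> \<ge> 1/4" for s
  proof -
    \<comment> \<open>Symmetrically, \<open>G\<close> has its minimum 0 here.\<close>
    have "G' x = 0" if "x \<ge> 1" for x
    proof (rule ccontr)
      assume "G' x \<noteq> 0"
      then have "G' x < 0" using G(5)[of x] by linarith
      from DERIV_neg_dec_right[OF G(4) this] obtain d where "d > 0" "\<And>h. 0 < h \<Longrightarrow> h < d \<Longrightarrow> G (x + h) < G x"
        by blast
      from this(2)[of "d/2"] this(1) G(3)[of "x + d/2"] G(2)[OF that] show False by simp
    qed
    with G(2) \<tau>1[OF that] show ?thesis by (simp add: h_def h'_def)
  qed
  show thesis
  proof (rule that[of a "\<lambda>x. h (x - 1/2)" "\<lambda>x. h' (x - 1/2)"])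
    show "((\<lambda>x. h (x - 1/2)) has_real_derivative h' (x - 1/2)) (at x)" for x
      by (rule DERIV_cong[OF DERIV_chain2[OF dh]]) (auto intro!: derivative_eq_intros)
    have "Ck_open k UNIV (\<lambda>x::real. x - 1/2)"
      by (intro Ck_open_diff Ck_open_const Ck_open_ident open_UNIV)
    then show "Ck_open k UNIV (\<lambda>x. h' (x - 1/2))"
      by (rule Ck_open_compose[OF open_UNIV open_UNIV _ Ch' subset_UNIV])
    show "0 < a" "a < 1/4" by (fact a)+
    show "h (x - 1/2) = x - 1/2 \<and> h' (x - 1/2) = 1" if "\<bar>x - 1/2\<bar> \<le> a" for x
      by (rule small[OF that])
    show "h (x - 1/2) = 0 \<and> h' (x - 1/2) = 0" if "\<bar>x - 1/2\<bar> \<ge> 1/4" for x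
      by (rule large[OF that])
    show "- \<epsilon> \<le> h' (x - 1/2) \<and> h' (x - 1/2) \<le> 1" for x
      by (rule bnd)
  qed
qed

section \<open>Lifting the circle map to the angle\<close>

lemma Ck_open_polar: "Ck_open k UNIV (\<lambda>\<theta>. polar r \<theta>)"
  unfolding polar_def
  using Ck_open_sin_cos by (intro Ck_open_Pair Ck_open_mult Ck_open_const open_UNIV) auto

lemma polar_eq_iff:
  assumes "r > 0" "s > 0"
  shows "polar r \<alpha> = polar s \<beta> \<longleftrightarrow> r = s \<and> (\<exists>n::int. \<alpha> = \<beta> + 2 * pi * of_int n)"
proof
  assume eq: "polar r \<alpha> = polar s \<beta>"
  then have e: "r * cos \<alpha> = s * cos \<beta>" "r * sin \<alpha> = s * sin \<beta>" by (auto simp: polar_def)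
  have "r\<^sup>2 * ((cos \<alpha>)\<^sup>2 + (sin \<alpha>)\<^sup>2) = s\<^sup>2 * ((cos \<beta>)\<^sup>2 + (sin \<beta>)\<^sup>2)"
    unfolding distrib_left power_mult_distrib[symmetric] e ..
  then have "r = s" using assms by simp
  moreover from this e have "sin \<alpha> = sin \<beta>" "cos \<alpha> = cos \<beta>" using assms by auto
  then have "\<exists>n::int. \<alpha> = \<beta> + 2 * pi * of_int n"
    using sin_cos_eq_iff by (metis)
  ultimately show "r = s \<and> (\<exists>n::int. \<alpha> = \<beta> + 2 * pi * of_int n)" by blast
next
  assume "r = s \<and> (\<exists>n::int. \<alpha> = \<beta> + 2 * pi * of_int n)"
  then show "polar r \<alpha> = polar s \<beta>"
    by (auto simp: polar_def sin_add cos_add)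
qed

lemma norm_polar: "norm (polar r \<theta>) = \<bar>r\<bar>"
proof -
  have "(r * cos \<theta>)\<^sup>2 + (r * sin \<theta>)\<^sup>2 = r\<^sup>2"
    by (simp add: power_mult_distrib flip: distrib_left)
  then show ?thesis by (simp add: polar_def norm_Pair)
qed

lemma polar_exists: obtains \<theta> where "p = polar (norm p) \<theta>"
proof (cases "p = 0")
  case True
  then show ?thesis using that[of 0] by (simp add: polar_def zero_prod_def)
next
  case False
  obtain x y where p: "p = (x, y)" by fastforce
  have n: "(norm p)\<^sup>2 = x\<^sup>2 + y\<^sup>2" by (simp add: p norm_Pair)
  have "(x / norm p)\<^sup>2 + (y / norm p)\<^sup>2 = 1"
    using False by (simp add: power_divide n flip: add_divide_distrib) (simp add: p zero_prod_def)
  then obtain t where "x / norm p = cos t" "y / norm p = sin t"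
    using sincos_total_2pi by metis
  then show ?thesis using that[of t] False by (simp add: p polar_def field_simps)
qed

lemma period_int:
  fixes g :: "real \<Rightarrow> 'a"
  assumes "\<And>x. g (x + T) = g x"
  shows "g (x + T * of_int n) = g x"
proof -
  have nat: "g (x + T * of_nat m) = g x" for m x
    by (induction m) (simp_all add: distrib_left, metis add.assoc add.commute assms)
  show ?thesis
  proof (cases n)
    case (nonneg m)
    then show ?thesis using nat by simp
  next
    case (neg m)
    then have "(of_int n :: real) = - of_nat (Suc m)" by simp
    then have eq: "x + T * of_int n + T * of_nat (Suc m) = x" by (simp only: mult_minus_right)
    show ?thesis using nat[of "x + T * of_int n" "Suc m"] unfolding eq by (rule sym)
  qed
qed

text \<open>Shifting by a multiple of the period brings every point into the compact interval
  \<open>{0..2 * pi}\<close>.\<close>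

lemma periodic_attains:
  fixes g :: "real \<Rightarrow> real"
  assumes "continuous_on UNIV g" "\<And>x. g (x + 2 * pi) = g x"
  obtains a b where "\<And>x. g a \<le> g x" "\<And>x. g x \<le> g b"
proof -
  have red: "\<exists>y\<in>{0..2 * pi}. g y = g x" for x
  proof -
    define n where "n = \<lfloor>x / (2 * pi)\<rfloor>"
    define y where "y = x + 2 * pi * of_int (- n)"
    have "of_int n \<le> x / (2 * pi)" "x / (2 * pi) \<le> of_int n + 1" unfolding n_def by linarith+
    then have "y \<in> {0..2 * pi}" using pi_gt_zero by (simp add: y_def field_simps)
    then show ?thesis using period_int[of g "2 * pi", OF assms(2)] unfolding y_def by blast
  qed
  have "compact {0..2 * pi}" "{0..2 * pi} \<noteq> {}" "continuous_on {0..2 * pi} g"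
    using assms(1) by (auto intro: continuous_on_subset)
  then obtain a b where "\<forall>y\<in>{0..2 * pi}. g a \<le> g y" "\<forall>y\<in>{0..2 * pi}. g y \<le> g b"
    using continuous_attains_inf continuous_attains_sup by metis
  then show ?thesis using that[of a b] red by metis
qed

text \<open>The curve c(\<theta>) = f(polar 1 \<theta>) turns with angular velocity
  \<open>q\<close>, the value of \<open>dxdy\<close> on c and its derivative, positive by
  orientation. \<open>F\<close> is an antiderivative of \<open>q\<close> with the right constant.
  One derivative of c enters \<open>q\<close>, whence its class C^k.\<close>

lemma angular_lift:
  fixes f :: "real \<times> real \<Rightarrow> real \<times> real"
  assumes f: "Ck_on (Suc k) S1 f" "f ` S1 \<subseteq> S1" "inj_on f S1"
    and orient: "orientation_preserving_S1 f"
  obtains F q :: "real \<Rightarrow> real"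
  where "\<And>\<theta>. f (polar 1 \<theta>) = polar 1 (F \<theta>)" "\<And>\<theta>. F (\<theta> + 2 * pi) = F \<theta> + 2 * pi"
    "\<And>\<theta>. (F has_real_derivative q \<theta>) (at \<theta>)" "\<And>\<theta>. q \<theta> > 0" "Ck_open k UNIV q"
proof -
  have S: "polar 1 \<theta> \<in> S1" for \<theta> by (simp add: norm_polar)
  define c where "c \<theta> = f (polar 1 \<theta>)" for \<theta>
  have per: "c (\<theta> + 2 * pi) = c \<theta>" for \<theta> by (simp add: c_def polar_def)
  \<comment> \<open>Near each angle, \<open>c\<close> is a local ambient extension of
    \<open>f\<close> composed with the parametrisation of the circle.\<close>
  have Cc: "Ck_open (Suc k) UNIV c"
  proof (rule Ck_open_local)
    fix t :: real
    obtain V g where V: "open V" "polar 1 t \<in> V" "Ck_open (Suc k) V g" "\<forall>x\<in>V \<inter> S1. g x = f x"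
      using f(1) S[of t] unfolding Ck_on_def by blast
    define U where "U = polar 1 -` V"
    have "open U" unfolding U_def
      by (rule open_vimage[OF V(1)]) (rule Ck_open_continuous_on[OF Ck_open_polar])
    moreover have "Ck_open (Suc k) U (\<lambda>\<theta>. g (polar 1 \<theta>))"
      by (rule Ck_open_compose[OF \<open>open U\<close> V(1) _ V(3)])
         (auto simp: U_def simp del: Ck_open.simps intro: Ck_open_subset[OF Ck_open_polar])
    ultimately show "\<exists>U F. open U \<and> t \<in> U \<and> Ck_open (Suc k) U F \<and> (\<forall>x\<in>U \<inter> UNIV. F x = c x)"
      using V(2,4) S unfolding c_def
      by (intro exI[of _ U] exI[of _ "\<lambda>\<theta>. g (polar 1 \<theta>)"]) (auto simp: U_def simp del: Ck_open.simps)
  qed simp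
  define c' where "c' \<theta> = frechet_derivative c (at \<theta>) 1" for \<theta>
  have dc: "(c has_vector_derivative c' \<theta>) (at \<theta>)" for \<theta>
  proof -
    have "(c has_derivative frechet_derivative c (at \<theta>)) (at \<theta>)"
      using Ck_open_Suc_derivative[OF Cc] by simp
    moreover from this have "frechet_derivative c (at \<theta>) = (\<lambda>x. x *\<^sub>R c' \<theta>)"
      unfolding c'_def by (intro ext) (metis has_derivative_linear linear_scale mult.right_neutral real_scaleR_def)
    ultimately show ?thesis by (simp add: has_vector_derivative_def)
  qed
  have Cc': "Ck_open k UNIV c'" unfolding c'_def by (rule Ck_open_frechet[OF Cc])
  define q where "q \<theta> = dxdy (c \<theta>) (c' \<theta>)" for \<theta>
  have qpos: "q \<theta> > 0" for \<theta>
    using orient vector_derivative_at[OF dc] unfolding orientation_preserving_S1_def q_def c_def by auto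
  have Cq: "Ck_open k UNIV q"
    unfolding q_def dxdy_def
    by (intro Ck_open_diff Ck_open_mult Ck_open_fst Ck_open_snd Ck_open_SucD[OF Cc] Cc' open_UNIV)
  define X Y X' Y' where "X \<theta> = fst (c \<theta>)" and "Y \<theta> = snd (c \<theta>)"
    and "X' \<theta> = fst (c' \<theta>)" and "Y' \<theta> = snd (c' \<theta>)" for \<theta>
  have dX: "(X has_real_derivative X' \<theta>) (at \<theta>)" and dY: "(Y has_real_derivative Y' \<theta>) (at \<theta>)" for \<theta>
    using bounded_linear.has_vector_derivative[OF bounded_linear_fst dc[of \<theta>]]
      bounded_linear.has_vector_derivative[OF bounded_linear_snd dc[of \<theta>]]
    unfolding X_def Y_def X'_def Y'_def has_real_derivative_iff_has_vector_derivative by auto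
  have XY: "(X \<theta>)\<^sup>2 + (Y \<theta>)\<^sup>2 = 1" for \<theta>
  proof -
    have "c \<theta> \<in> S1" using f(2) S unfolding c_def by blast
    then have "norm (X \<theta>, Y \<theta>) = 1" by (simp add: X_def Y_def)
    then show ?thesis by (simp add: norm_Pair)
  qed
  have XX: "X \<theta> * X' \<theta> + Y \<theta> * Y' \<theta> = 0" for \<theta>
  proof -
    have "((\<lambda>t. (X t)\<^sup>2 + (Y t)\<^sup>2) has_real_derivative 2 * (X \<theta> * X' \<theta> + Y \<theta> * Y' \<theta>)) (at \<theta>)"
      by (rule derivative_eq_intros dX dY refl)+ simp
    then show ?thesis unfolding XY using DERIV_unique[OF _ DERIV_const] by fastforce
  qed
  have qXY: "q \<theta> = X \<theta> * Y' \<theta> - Y \<theta> * X' \<theta>" for \<theta>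
    by (simp add: q_def dxdy_def X_def Y_def X'_def Y'_def)
  \<comment> \<open>The velocity is orthogonal to the unit vector \<open>c \<theta>\<close>, hence
    equals \<open>q \<theta>\<close> times that vector turned by a right angle.\<close>
  have X': "X' \<theta> = - q \<theta> * Y \<theta>" and Y': "Y' \<theta> = q \<theta> * X \<theta>" for \<theta>
  proof -
    have "X' \<theta> = X' \<theta> * ((X \<theta>)\<^sup>2 + (Y \<theta>)\<^sup>2)" "Y' \<theta> = Y' \<theta> * ((X \<theta>)\<^sup>2 + (Y \<theta>)\<^sup>2)"
      by (simp_all add: XY)
    moreover have "X \<theta> * (X \<theta> * X' \<theta> + Y \<theta> * Y' \<theta>) = 0" "Y \<theta> * (X \<theta> * X' \<theta> + Y \<theta> * Y' \<theta>) = 0"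
      by (simp_all add: XX)
    ultimately show "X' \<theta> = - q \<theta> * Y \<theta>" "Y' \<theta> = q \<theta> * X \<theta>"
      unfolding qXY by (simp_all add: power2_eq_square algebra_simps)
  qed
  obtain F0 where F0: "\<And>\<theta>. (F0 has_real_derivative q \<theta>) (at \<theta>)"
  proof -
    have "\<exists>F. \<forall>x. - \<infinity> < ereal x \<longrightarrow> ereal x < \<infinity> \<longrightarrow> (F has_vector_derivative q x) (at x)"
      by (rule einterval_antiderivative)
         (use Ck_open_continuous_on[OF Cq] in \<open>auto simp: continuous_on_eq_continuous_at\<close>)
    then show ?thesis using that by (auto simp: has_real_derivative_iff_has_vector_derivative)
  qed
  \<comment> \<open>As a complex number, m + i n is \<open>c\<close> rotated by \<open>- F0\<close>.
    Both turn at speed \<open>q\<close>, so it is constant, and its angle \<open>\<beta>\<close> is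
    the missing constant of integration.\<close>
  define m n where "m \<theta> = X \<theta> * cos (F0 \<theta>) + Y \<theta> * sin (F0 \<theta>)"
    and "n \<theta> = Y \<theta> * cos (F0 \<theta>) - X \<theta> * sin (F0 \<theta>)" for \<theta>
  have "(m has_real_derivative 0) (at \<theta>)" for \<theta>
    unfolding m_def
    by (rule derivative_eq_intros dX dY F0 refl)+ (simp add: X' Y' algebra_simps)
  then have m: "m \<theta> = m 0" for \<theta> by (rule DERIV_isconst_all[rule_format])
  have "(n has_real_derivative 0) (at \<theta>)" for \<theta>
    unfolding n_def
    by (rule derivative_eq_intros dX dY F0 refl)+ (simp add: X' Y' algebra_simps)
  then have n: "n \<theta> = n 0" for \<theta> by (rule DERIV_isconst_all[rule_format])
  have "(m 0)\<^sup>2 + (n 0)\<^sup>2 = 1"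
  proof -
    have "(m 0)\<^sup>2 + (n 0)\<^sup>2 = ((X 0)\<^sup>2 + (Y 0)\<^sup>2) * ((sin (F0 0))\<^sup>2 + (cos (F0 0))\<^sup>2)"
      unfolding m_def n_def by algebra
    then show ?thesis by (simp add: XY)
  qed
  then obtain \<beta> where \<beta>: "m 0 = cos \<beta>" "n 0 = sin \<beta>" using sincos_total_2pi by metis
  define F where "F \<theta> = F0 \<theta> + \<beta>" for \<theta>
  have dF: "(F has_real_derivative q \<theta>) (at \<theta>)" for \<theta>
    unfolding F_def by (rule derivative_eq_intros F0 refl)+ simp
  have cF: "c \<theta> = polar 1 (F \<theta>)" for \<theta>
  proof -
    have "X \<theta> = m \<theta> * cos (F0 \<theta>) - n \<theta> * sin (F0 \<theta>)" "Y \<theta> = n \<theta> * cos (F0 \<theta>) + m \<theta> * sin (F0 \<theta>)"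
    proof -
      have "X \<theta> = X \<theta> * ((sin (F0 \<theta>))\<^sup>2 + (cos (F0 \<theta>))\<^sup>2)" "Y \<theta> = Y \<theta> * ((sin (F0 \<theta>))\<^sup>2 + (cos (F0 \<theta>))\<^sup>2)"
        by simp_all
      then show "X \<theta> = m \<theta> * cos (F0 \<theta>) - n \<theta> * sin (F0 \<theta>)" "Y \<theta> = n \<theta> * cos (F0 \<theta>) + m \<theta> * sin (F0 \<theta>)"
        unfolding m_def n_def by algebra+
    qed
    then have "X \<theta> = cos (F \<theta>)" "Y \<theta> = sin (F \<theta>)"
      unfolding m[of \<theta>] n[of \<theta>] \<beta> F_def by (simp_all add: cos_add sin_add algebra_simps)
    then show ?thesis by (simp add: polar_def X_def Y_def prod_eq_iff)
  qed
  have mono: "F s < F t" if "s < t" for s t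
    using DERIV_pos_imp_increasing[OF that] dF qpos by blast
  have contF: "continuous_on A F" for A
    using dF DERIV_isCont by (blast intro: continuous_at_imp_continuous_on)
  have qper: "q (\<theta> + 2 * pi) = q \<theta>" for \<theta>
  proof -
    have "((\<lambda>t. c (t + 2 * pi)) has_vector_derivative c' (\<theta> + 2 * pi)) (at \<theta>)"
    proof -
      have "((\<lambda>t. t + 2 * pi) has_vector_derivative 1) (at \<theta>)"
        by (auto simp: has_real_derivative_iff_has_vector_derivative[symmetric] intro!: derivative_eq_intros)
      from vector_diff_chain_at[OF this dc] show ?thesis by (simp add: o_def)
    qed
    then have "c' (\<theta> + 2 * pi) = c' \<theta>" unfolding per using dc vector_derivative_unique_at by blast
    then show ?thesis by (simp add: q_def per)
  qed
  \<comment> \<open>\<open>d\<close> is constant because \<open>q\<close> is periodic; its value is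
    \<open>2 * pi\<close> times the degree of \<open>f\<close>.\<close>
  define d where "d \<theta> = F (\<theta> + 2 * pi) - F \<theta>" for \<theta>
  have "((\<lambda>t. F (t + 2 * pi)) has_real_derivative q \<theta>) (at \<theta>)" for \<theta>
    using dF[of "\<theta> + 2 * pi"] unfolding DERIV_shift qper .
  then have "(d has_real_derivative 0) (at \<theta>)" for \<theta>
    unfolding d_def using DERIV_diff[OF _ dF] by fastforce
  then have d: "d \<theta> = d 0" for \<theta> by (rule DERIV_isconst_all[rule_format])
  text \<open>The degree is one: it is positive as \<open>F\<close> increases, and a value of at least two would make
    \<open>F\<close> gain \<open>2 \<pi>\<close> before a full turn, against injectivity of \<open>f\<close>.\<close>
  have "d 0 = 2 * pi"
  proof (rule ccontr)
    assume ne: "d 0 \<noteq> 2 * pi"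
    have "polar 1 (F (0 + 2 * pi)) = polar 1 (F 0)" using per[of 0] unfolding cF .
    then obtain n :: int where n: "F (2 * pi) = F 0 + 2 * pi * of_int n"
      unfolding polar_eq_iff[OF zero_less_one zero_less_one] by auto
    then have "d 0 = 2 * pi * of_int n" by (simp add: d_def)
    moreover have "d 0 > 0" using mono[of 0 "2 * pi"] by (simp add: d_def)
    ultimately have "n > 0" "n \<noteq> 1" using ne by (auto simp: zero_less_mult_iff)
    then have "real_of_int n \<ge> 2" by linarith
    then have "F 0 + 2 * pi \<le> F (2 * pi)" "F (2 * pi) \<noteq> F 0 + 2 * pi" using pi_gt_zero unfolding n
      by (auto intro: order_trans[OF _ mult_left_mono[of 2 "real_of_int n" "2*pi"]])
    then obtain t where t: "0 \<le> t" "t \<le> 2 * pi" "F t = F 0 + 2 * pi"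
      using IVT'[of F 0 "F 0 + 2 * pi" "2 * pi"] contF by auto
    with \<open>F (2 * pi) \<noteq> F 0 + 2 * pi\<close> have "t \<noteq> 2 * pi" "t \<noteq> 0" by auto
    with t have t': "0 < t" "t < 2 * pi" by auto
    have "f (polar 1 t) = f (polar 1 0)"
      using cF[of t] cF[of 0] t(3) by (simp add: c_def polar_def)
    then have "polar 1 t = polar 1 0" using f(3) S by (meson inj_onD)
    then obtain j :: int where "t = 2 * pi * of_int j"
      unfolding polar_eq_iff[OF zero_less_one zero_less_one] by auto
    with t' have "0 < real_of_int j" "real_of_int j < 1" by (auto simp: zero_less_mult_iff)
    then show False by simp
  qed
  then have "F (\<theta> + 2 * pi) = F \<theta> + 2 * pi" for \<theta> using d[of \<theta>] unfolding d_def by simp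
  with that[OF _ _ dF qpos Cq] cF show thesis by (simp add: c_def)
qed

section \<open>Action-angle coordinates\<close>

text \<open>The first coordinate is the action I = r^2 / 2. Since r dr = dI, the area form becomes
  the standard one in I and \<theta>.\<close>

definition action_angle :: "real \<times> real \<Rightarrow> real \<times> real" where
  "action_angle x = polar (sqrt (2 * fst x)) (snd x)"

lemma action_angle_polar: "r > 0 \<Longrightarrow> action_angle (r\<^sup>2 / 2, \<theta>) = polar r \<theta>"
  by (simp add: action_angle_def)

lemma norm_action_angle: "fst x > 0 \<Longrightarrow> (norm (action_angle x))\<^sup>2 = 2 * fst x"
  by (simp add: action_angle_def norm_polar)

lemma action_angle_eq_iff:
  assumes "fst x > 0" "fst y > 0"
  shows "action_angle x = action_angle y \<longleftrightarrow>
    fst x = fst y \<and> (\<exists>n::int. snd x = snd y + 2 * pi * of_int n)"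
  using assms by (simp add: action_angle_def polar_eq_iff)

lemma action_angle_surj:
  assumes "p \<noteq> 0"
  obtains x where "fst x > 0" "action_angle x = p"
proof -
  obtain \<theta> where "p = polar (norm p) \<theta>" by (rule polar_exists)
  with assms action_angle_polar[of "norm p" \<theta>] show thesis
    by (intro that[of "((norm p)\<^sup>2 / 2, \<theta>)"]) auto
qed

lemma open_action_positive: "open {x :: real \<times> real. fst x > 0}"
  by (intro open_Collect_less continuous_intros)

lemma Ck_open_action_angle: "Ck_open k {x. fst x > 0} action_angle"
proof -
  let ?S = "{x :: real \<times> real. fst x > 0}"
  have S: "Ck_open k ?S (\<lambda>x. sqrt (2 * fst x))"
    by (rule Ck_open_compose[OF open_action_positive open_greaterThan _ Ck_open_sqrt])
       (intro Ck_open_mult Ck_open_const Ck_open_fst Ck_open_ident open_action_positive, auto)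
  have "Ck_open k ?S snd"
    by (rule Ck_open_linear[OF open_action_positive bounded_linear_snd])
  note Ck_open_compose[OF open_action_positive open_UNIV this _ subset_UNIV]
  from this[OF Ck_open_sin_cos[THEN conjunct2]] this[OF Ck_open_sin_cos[THEN conjunct1]]
  have "Ck_open k ?S (\<lambda>x. cos (snd x))" "Ck_open k ?S (\<lambda>x. sin (snd x))" .
  with S show ?thesis
    unfolding action_angle_def[abs_def] polar_def
    by (intro Ck_open_Pair Ck_open_mult open_action_positive)
qed

lemma has_derivative_comp_fst:
  fixes h :: "real \<Rightarrow> real" and x :: "real \<times> real"
  assumes "(h has_real_derivative d) (at (fst x))"
  shows "((\<lambda>x. h (fst x)) has_derivative (\<lambda>v. d * fst v)) (at x)"
  using assms bounded_linear_imp_has_derivative[OF bounded_linear_fst, of "at x"]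
  unfolding has_field_derivative_def by (rule has_derivative_compose[rotated])

lemma has_derivative_comp_snd:
  fixes h :: "real \<Rightarrow> real" and x :: "real \<times> real"
  assumes "(h has_real_derivative d) (at (snd x))"
  shows "((\<lambda>x. h (snd x)) has_derivative (\<lambda>v. d * snd v)) (at x)"
  using assms bounded_linear_imp_has_derivative[OF bounded_linear_snd, of "at x"]
  unfolding has_field_derivative_def by (rule has_derivative_compose[rotated])

text \<open>The derivative 1/r of r = sqrt(2 I) cancels the factor r of the angular
  derivative.\<close>

lemma plane_jacobian_action_angle:
  assumes "fst x > 0"
  shows "plane_jacobian action_angle x = 1"
proof -
  obtain I \<theta> where x: "x = (I, \<theta>)" by fastforce
  with assms have I: "I > 0" by simp
  let ?r = "sqrt (2 * I)"
  have "((\<lambda>t. sqrt (2 * t)) has_real_derivative inverse ?r) (at (fst x))"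
    by (rule DERIV_cong[OF DERIV_chain2[OF DERIV_real_sqrt DERIV_cmult_Id]]) (use I in \<open>simp_all add: x\<close>)
  note r = has_derivative_comp_fst[OF this]
  note c = has_derivative_comp_snd[OF DERIV_cos] and s = has_derivative_comp_snd[OF DERIV_sin]
  have "(action_angle has_derivative
      (\<lambda>v. (?r * (- sin \<theta> * snd v) + inverse ?r * fst v * cos \<theta>,
            ?r * (cos \<theta> * snd v) + inverse ?r * fst v * sin \<theta>))) (at x)"
    using has_derivative_Pair[OF has_derivative_mult[OF r c] has_derivative_mult[OF r s]]
    unfolding action_angle_def[abs_def] polar_def x fst_conv snd_conv .
  from plane_jacobian_eq[OF this]
  have "plane_jacobian action_angle x = (?r * inverse ?r) * ((sin \<theta>)\<^sup>2 + (cos \<theta>)\<^sup>2)"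
    unfolding dxdy_def distrib_left power2_eq_square by simp
  with I show ?thesis by simp
qed

text \<open>On the half-plane of points at an acute angle to \<open>p0\<close>, the angle from
  \<open>p0\<close> is the arctangent of cross product over dot product. This yields local inverses
  without a global branch of the argument.\<close>

lemma action_angle_section:
  assumes "p0 \<noteq> 0"
  obtains V Q where "open V" "p0 \<in> V" "Ck_open k V Q"
    "\<And>p. p \<in> V \<Longrightarrow> fst (Q p) > 0" "\<And>p. p \<in> V \<Longrightarrow> action_angle (Q p) = p"
proof -
  obtain \<theta> where \<theta>: "p0 = polar (norm p0) \<theta>" by (rule polar_exists)
  define V where "V = {p. p0 \<bullet> p > 0}"
  define Q where "Q p = ((fst p * fst p + snd p * snd p) * (1/2),
      \<theta> + arctan (dxdy p0 p * inverse (p0 \<bullet> p)))" for p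
  have V: "open V" unfolding V_def by (intro open_Collect_less continuous_intros)
  have p0: "p0 \<in> V" using assms by (simp add: V_def)
  have Cd: "Ck_open k V (\<lambda>p. p0 \<bullet> p)"
    by (rule Ck_open_linear[OF V bounded_linear_inner_right])
  have C1: "Ck_open k V (\<lambda>p. dxdy p0 p * inverse (p0 \<bullet> p))"
    unfolding dxdy_def
    by (intro Ck_open_mult Ck_open_diff Ck_open_const Ck_open_fst Ck_open_snd Ck_open_ident
        Ck_open_inverse Cd V) (simp add: V_def)
  have CQ: "Ck_open k V Q"
    unfolding Q_def
    by (intro Ck_open_Pair Ck_open_mult Ck_open_add Ck_open_const Ck_open_fst Ck_open_snd Ck_open_ident V
        Ck_open_compose[OF V open_UNIV C1 Ck_open_arctan subset_UNIV])
  have norm2: "fst p * fst p + snd p * snd p = (norm p)\<^sup>2" for p :: "real \<times> real"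
    by (cases p) (simp add: norm_Pair power2_eq_square)
  have pos: "fst (Q p) > 0" if "p \<in> V" for p
  proof -
    have "p \<noteq> 0" using that by (auto simp: V_def)
    then show ?thesis by (simp add: Q_def norm2)
  qed
  have sec: "action_angle (Q p) = p" if p: "p \<in> V" for p
  proof -
    have "p \<noteq> 0" using p by (auto simp: V_def)
    obtain \<beta> where \<beta>: "p = polar (norm p) \<beta>" by (rule polar_exists)
    define \<delta> where "\<delta> = \<beta> - \<theta>"
    define R where "R = norm p0 * norm p"
    have R: "R > 0" using assms \<open>p \<noteq> 0\<close> by (simp add: R_def)
    have dot: "p0 \<bullet> p = R * cos \<delta>"
      by (subst \<theta>, subst \<beta>) (simp add: polar_def R_def \<delta>_def cos_diff algebra_simps)
    have cross: "dxdy p0 p = R * sin \<delta>"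
      by (subst \<theta>, subst \<beta>) (simp add: dxdy_def polar_def R_def \<delta>_def sin_diff algebra_simps)
    \<comment> \<open>The positive cosine ensures that \<open>arctan\<close> recovers the right sine
      and cosine, not their negatives.\<close>
    have cpos: "cos \<delta> > 0" using p R by (simp add: V_def dot zero_less_mult_iff)
    let ?t = "arctan (dxdy p0 p * inverse (p0 \<bullet> p))"
    have "dxdy p0 p * inverse (p0 \<bullet> p) = tan \<delta>"
      using R by (simp add: dot cross tan_def field_simps)
    moreover have "sqrt (1 + (tan \<delta>)\<^sup>2) = 1 / cos \<delta>"
    proof (rule real_sqrt_unique)
      have "(1 + (tan \<delta>)\<^sup>2) * (cos \<delta>)\<^sup>2 = (cos \<delta>)\<^sup>2 + (sin \<delta>)\<^sup>2"
        using cpos by (simp add: tan_def field_simps)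
      then show "(1 / cos \<delta>)\<^sup>2 = 1 + (tan \<delta>)\<^sup>2" using cpos by (simp add: field_simps)
    qed (use cpos in simp)
    ultimately have "cos ?t = cos \<delta>" "sin ?t = sin \<delta>"
      using cpos by (simp_all add: cos_arctan sin_arctan tan_def)
    then have "cos (\<theta> + ?t) = cos \<beta>" "sin (\<theta> + ?t) = sin \<beta>"
      using cos_add[of \<theta> \<delta>] sin_add[of \<theta> \<delta>] by (simp_all add: cos_add sin_add \<delta>_def)
    moreover have "sqrt (2 * fst (Q p)) = norm p" by (simp add: Q_def norm2)
    ultimately have "action_angle (Q p) = polar (norm p) \<beta>"
      by (simp add: action_angle_def polar_def Q_def)
    with \<beta> show ?thesis by simp
  qed
  show thesis by (rule that[OF V p0 CQ pos sec])
qed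

text \<open>Maps of the action-angle strip that descend to the plane; the identity for small action
  removes the singularity at the origin.\<close>

definition annular_map :: "(real \<times> real \<Rightarrow> real \<times> real) \<Rightarrow> bool" where
  "annular_map \<Phi> \<longleftrightarrow> (\<forall>x. \<Phi> (x + (0, 2 * pi)) = \<Phi> x + (0, 2 * pi)) \<and>
     (\<forall>x. fst x \<le> 1/4 \<longrightarrow> \<Phi> x = x) \<and> (\<forall>x. fst x > 0 \<longrightarrow> fst (\<Phi> x) > 0)"

text \<open>The choice of lift is immaterial for annular maps, which commute with the shift by a
  full turn. The origin, having no lift of positive action, is sent to itself.\<close>

definition descend :: "(real \<times> real \<Rightarrow> real \<times> real) \<Rightarrow> real \<times> real \<Rightarrow> real \<times> real" where
  "descend \<Phi> p = (if p = 0 then 0 else action_angle (\<Phi> (SOME x. fst x > 0 \<and> action_angle x = p)))"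

text \<open>\<open>\<Psi>\<close> fixes every point of nonpositive action; if
  \<open>\<Phi> x\<close> were such a point, then \<open>x = \<Psi> (\<Phi> x) = \<Phi> x\<close>
  would be one too.\<close>

lemma annular_mapI:
  assumes "\<And>x. \<Phi> (x + (0, 2 * pi)) = \<Phi> x + (0, 2 * pi)"
    and "\<And>x. fst x \<le> 1/4 \<Longrightarrow> \<Phi> x = x" "\<And>x. fst x \<le> 1/4 \<Longrightarrow> \<Psi> x = x" "\<And>x. \<Psi> (\<Phi> x) = x"
  shows "annular_map \<Phi>"
proof -
  have "fst (\<Phi> x) > 0" if "fst x > 0" for x
  proof (rule ccontr)
    assume "\<not> fst (\<Phi> x) > 0"
    then have "\<Psi> (\<Phi> x) = \<Phi> x" by (intro assms(3)) simp
    with assms(4)[of x] have "\<Phi> x = x" by simp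
    with that \<open>\<not> fst (\<Phi> x) > 0\<close> show False by simp
  qed
  with assms(1,2) show ?thesis unfolding annular_map_def by blast
qed

lemma descend_action_angle:
  assumes "annular_map \<Phi>" "fst x > 0"
  shows "descend \<Phi> (action_angle x) = action_angle (\<Phi> x)"
proof -
  define y where "y = (SOME y. fst y > 0 \<and> action_angle y = action_angle x)"
  have y: "fst y > 0 \<and> action_angle y = action_angle x"
    unfolding y_def by (rule someI[of _ x]) (simp add: assms)
  then obtain n :: int where "fst y = fst x" "snd y = snd x + 2 * pi * of_int n"
    using action_angle_eq_iff[of y x] assms(2) by auto
  then have n: "y = x + (0, 2 * pi * of_int n)" by (simp add: prod_eq_iff)
  \<comment> \<open>Subtracting the angle turns equivariance into periodicity, so
    \<open>period_int\<close> covers all integer multiples.\<close>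
  have "\<Phi> (x + (0, t + 2 * pi)) - (0, t + 2 * pi) = \<Phi> (x + (0, t)) - (0, t)" for t
  proof -
    have shift: "x + (0, t + 2 * pi) = (x + (0, t)) + (0, 2 * pi)" by (simp add: prod_eq_iff)
    have "\<Phi> ((x + (0, t)) + (0, 2 * pi)) = \<Phi> (x + (0, t)) + (0, 2 * pi)"
      using assms(1) unfolding annular_map_def by blast
    then show ?thesis unfolding shift by (simp add: prod_eq_iff)
  qed
  from period_int[of "\<lambda>t. \<Phi> (x + (0, t)) - (0, t)" "2 * pi" 0 n, OF this]
  have "\<Phi> y = \<Phi> x + (0, 2 * pi * of_int n)"
    by (simp add: n algebra_simps zero_prod_def[symmetric])
  moreover have "fst (\<Phi> x) > 0" "fst (\<Phi> y) > 0"
    using assms y unfolding annular_map_def by blast+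
  ultimately have "action_angle (\<Phi> y) = action_angle (\<Phi> x)"
    using action_angle_eq_iff[of "\<Phi> y" "\<Phi> x"] by auto
  moreover have "action_angle x \<noteq> 0"
    using norm_action_angle[OF assms(2)] assms(2) by auto
  ultimately show ?thesis unfolding descend_def y_def by simp
qed

text \<open>Norm below 1/2 means action below 1/8, inside the region where \<open>\<Phi>\<close> is
  the identity.\<close>

lemma descend_near_zero:
  assumes "annular_map \<Phi>" "norm p < 1/2"
  shows "descend \<Phi> p = p"
proof (cases "p = 0")
  case True
  then show ?thesis by (simp add: descend_def)
next
  case False
  then obtain x where x: "fst x > 0" "action_angle x = p" by (rule action_angle_surj)
  have "(norm p)\<^sup>2 < (1/2)\<^sup>2" using assms(2) by (intro power_strict_mono) auto
  then have "fst x \<le> 1/4" using norm_action_angle[OF x(1)] x(2) by (simp add: power2_eq_square)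
  then have "\<Phi> x = x" using assms(1) unfolding annular_map_def by blast
  with descend_action_angle[OF assms(1) x(1)] x(2) show ?thesis by simp
qed

text \<open>Near the origin the map is the identity; elsewhere a local section \<open>Q\<close>
  presents it as \<open>action_angle (\<Phi> (Q p))\<close>.\<close>

lemma Ck_open_descend:
  assumes "annular_map \<Phi>" "Ck_open k UNIV \<Phi>"
  shows "Ck_open k UNIV (descend \<Phi>)"
proof (rule Ck_open_local)
  fix p0 :: "real \<times> real"
  show "\<exists>U F. open U \<and> p0 \<in> U \<and> Ck_open k U F \<and> (\<forall>x\<in>U \<inter> UNIV. F x = descend \<Phi> x)"
  proof (cases "p0 = 0")
    case True
    then show ?thesis
      using descend_near_zero[OF assms(1)]
      by (intro exI[of _ "ball 0 (1/2)"] exI[of _ "\<lambda>x. x"]) (auto intro: Ck_open_ident)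
  next
    case False
    obtain V Q where V: "open V" "p0 \<in> V" "Ck_open k V Q"
      "\<And>p. p \<in> V \<Longrightarrow> fst (Q p) > 0" "\<And>p. p \<in> V \<Longrightarrow> action_angle (Q p) = p"
      using action_angle_section[OF False, of k thesis] by blast
    have "Ck_open k V (\<lambda>p. \<Phi> (Q p))"
      by (rule Ck_open_compose[OF V(1) open_UNIV V(3) assms(2) subset_UNIV])
    moreover have "(\<lambda>p. \<Phi> (Q p)) ` V \<subseteq> {x. fst x > 0}"
      using V(4) assms(1) unfolding annular_map_def by blast
    ultimately have "Ck_open k V (\<lambda>p. action_angle (\<Phi> (Q p)))"
      by (rule Ck_open_compose[OF V(1) open_action_positive _ Ck_open_action_angle])
    moreover have "action_angle (\<Phi> (Q p)) = descend \<Phi> p" if "p \<in> V" for p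
      using descend_action_angle[OF assms(1) V(4)[OF that]] V(5)[OF that] by simp
    ultimately show ?thesis
      using V(1,2) by (intro exI[of _ V] exI[of _ "\<lambda>p. action_angle (\<Phi> (Q p))"]) simp
  qed
qed simp

text \<open>Away from the origin all three factors of \<open>action_angle (\<Phi> (Q p))\<close>
  have Jacobian 1, \<open>Q\<close> because it is a right inverse of the area-preserving
  \<open>action_angle\<close>.\<close>

lemma plane_jacobian_descend:
  assumes "annular_map \<Phi>" "Ck_open k UNIV \<Phi>" "k > 0" "\<And>x. plane_jacobian \<Phi> x = 1"
  shows "plane_jacobian (descend \<Phi>) p = 1"
proof (cases "p = 0")
  case True
  have "plane_jacobian (descend \<Phi>) p = plane_jacobian (\<lambda>x. x) p"
    by (rule plane_jacobian_cong[of "ball 0 (1/2)"])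
       (use True descend_near_zero[OF assms(1)] in auto)
  then show ?thesis by (simp add: plane_jacobian_ident)
next
  case False
  obtain V Q where V: "open V" "p \<in> V" "Ck_open k V Q"
    "\<And>p. p \<in> V \<Longrightarrow> fst (Q p) > 0" "\<And>p. p \<in> V \<Longrightarrow> action_angle (Q p) = p"
    using action_angle_section[OF False, of k thesis] by blast
  have dQ: "Q differentiable (at p)" by (rule Ck_open_differentiable[OF V(3) assms(3) V(2)])
  have dP: "action_angle differentiable (at x)" if "fst x > 0" for x
    by (rule Ck_open_differentiable[OF Ck_open_action_angle assms(3)]) (simp add: that)
  have d\<Phi>: "\<Phi> differentiable (at x)" for x
    by (rule Ck_open_differentiable[OF assms(2,3)]) simp
  have pos: "fst (Q p) > 0" "fst (\<Phi> (Q p)) > 0"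
    using V(2,4) assms(1) unfolding annular_map_def by blast+
  have "plane_jacobian (\<lambda>x. action_angle (Q x)) p = plane_jacobian (\<lambda>x. x) p"
    by (rule plane_jacobian_cong[OF V(1,2)]) (simp_all add: V(5))
  then have JQ: "plane_jacobian Q p = 1"
    using plane_jacobian_compose[OF dQ dP[OF pos(1)]]
    by (simp add: plane_jacobian_ident plane_jacobian_action_angle[OF pos(1)])
  have d1: "(\<lambda>x. \<Phi> (Q x)) differentiable (at p)"
    using differentiable_chain_at[OF dQ d\<Phi>] by (simp add: o_def)
  have d2: "(\<lambda>x. action_angle (\<Phi> (Q x))) differentiable (at p)"
    using differentiable_chain_at[OF d1 dP[OF pos(2)]] by (simp add: o_def)
  have "plane_jacobian (descend \<Phi>) p = plane_jacobian (\<lambda>x. action_angle (\<Phi> (Q x))) p"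
  proof (rule plane_jacobian_cong[OF V(1,2) _ d2])
    fix x assume "x \<in> V"
    then show "action_angle (\<Phi> (Q x)) = descend \<Phi> x"
      using descend_action_angle[OF assms(1) V(4)] V(5) by metis
  qed
  also have "\<dots> = 1"
    using plane_jacobian_compose[OF d1 dP[OF pos(2)]] plane_jacobian_compose[OF dQ d\<Phi>]
    by (simp add: JQ assms(4) plane_jacobian_action_angle[OF pos(2)])
  finally show ?thesis .
qed

lemma descend_inverse:
  assumes "annular_map \<Phi>" "annular_map \<Psi>" "\<And>x. \<Phi> (\<Psi> x) = x"
  shows "descend \<Phi> (descend \<Psi> p) = p"
proof (cases "p = 0")
  case True
  then show ?thesis by (simp add: descend_def)
next
  case False
  then obtain x where x: "fst x > 0" "action_angle x = p" by (rule action_angle_surj)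
  then have "fst (\<Psi> x) > 0" using assms(2) unfolding annular_map_def by blast
  from descend_action_angle[OF assms(1) this] descend_action_angle[OF assms(2) x(1)]
  show ?thesis by (simp add: assms(3) x(2))
qed

section \<open>The extension\<close>

text \<open>The bound places \<open>y\<close> between the values of \<open>g\<close> at
  \<open>y - C\<close> and \<open>y + C\<close>, so the intermediate value theorem gives
  surjectivity.\<close>

lemma bij_increasing_near_id:
  fixes g :: "real \<Rightarrow> real"
  assumes deriv: "\<And>x. (g has_real_derivative g' x) (at x)" "\<And>x. g' x > 0"
    and bound: "\<And>x. \<bar>g x - x\<bar> \<le> C"
  shows "bij g"
proof (rule bijI)
  have "g x < g y" if "x < y" for x y
    using DERIV_pos_imp_increasing[OF that] deriv by blast
  then show "inj g" by (intro linorder_injI) (metis less_irrefl)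
  show "surj g"
  proof (rule surj_def[THEN iffD2, rule_format])
    fix y
    have "g (y - C) \<le> y" "y \<le> g (y + C)" "y - C \<le> y + C"
      using bound[of "y - C"] bound[of "y + C"] by linarith+
    moreover have "continuous_on {y - C..y + C} g"
      using deriv(1) DERIV_isCont by (blast intro: continuous_at_imp_continuous_on)
    ultimately show "\<exists>x. y = g x" using IVT'[of g "y - C" y "y + C"] by metis
  qed
qed

lemma plane_diffeo:
  assumes "bij A" "Ck_open k UNIV A" "k > 0" "\<And>x. plane_jacobian A x \<noteq> 0"
  shows "Ck_open k UNIV (inv A)"
  using assms by (intro Ck_open_inverse_map[OF assms(2,3)])
    (auto simp: bij_is_inj bij_is_surj surj_f_inv_f)

text \<open>Orientation matters for the angular form: with F' < 0 an area-preserving map of this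
  form would exchange the two sides of the circle, whereas a homeomorphism of the plane preserving
  the circle keeps its bounded side.\<close>

theorem theorem2:
  fixes f :: "real \<times> real \<Rightarrow> real \<times> real" and k :: nat
  assumes "k > 0"
    and "Ck_diffeo (k + 1) S1 S1 f"
    and "orientation_preserving_S1 f"
  shows "\<exists>\<phi>. Ck_symplectomorphism k \<phi> \<and> (\<forall>p\<in>S1. \<phi> p = f p) \<and> angular_form_near_S1 f \<phi>"
proof -
  from assms(2) have f: "Ck_on (Suc k) S1 f" "f ` S1 \<subseteq> S1" "inj_on f S1"
    unfolding Ck_diffeo_def bij_betw_def by auto

  \<comment> \<open>The lift, its displacement and their bounds\<close>
  obtain F q :: "real \<Rightarrow> real"
    where fF: "\<And>\<theta>. f (polar 1 \<theta>) = polar 1 (F \<theta>)"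
      and Fper: "\<And>\<theta>. F (\<theta> + 2 * pi) = F \<theta> + 2 * pi"
      and dF: "\<And>\<theta>. (F has_real_derivative q \<theta>) (at \<theta>)"
      and q: "\<And>\<theta>. q \<theta> > 0" and Cq: "Ck_open k UNIV q"
    using angular_lift[OF f assms(3)] by blast
  have qper: "q (\<theta> + 2 * pi) = q \<theta>" for \<theta>
  proof -
    have "((\<lambda>t. F (t + 2 * pi)) has_real_derivative q (\<theta> + 2 * pi)) (at \<theta>)"
      using dF[of "\<theta> + 2 * pi"] unfolding DERIV_shift .
    moreover have "((\<lambda>t. F (t + 2 * pi)) has_real_derivative q \<theta>) (at \<theta>)"
      unfolding Fper by (rule derivative_eq_intros dF refl)+ simp
    ultimately show ?thesis by (rule DERIV_unique)
  qed
  \<comment> \<open>The minimum of \<open>q\<close> is attained, hence positive. It sets the width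
    of the neighbourhood \<open>U\<close>, while \<open>qmax\<close> sets
    \<open>\<epsilon>\<close>.\<close>
  obtain qmin qmax where qbound: "\<And>\<theta>. qmin \<le> q \<theta>" "\<And>\<theta>. q \<theta> \<le> qmax" "qmin > 0"
    using periodic_attains[OF Ck_open_continuous_on[OF Cq] qper] q by metis
  \<comment> \<open>This derivative enters that of \<open>A\<close> but drops out of its
    Jacobian.\<close>
  have "\<exists>q'. (q has_real_derivative q') (at \<theta>)" for \<theta>
    using Ck_open_differentiable[OF Cq assms(1)] by (simp add: real_differentiable_def)
  then obtain q' where dq: "\<And>\<theta>. (q has_real_derivative q' \<theta>) (at \<theta>)" by metis
  have CF: "Ck_open k UNIV F"
    using Ck_open_SucD[OF Ck_open_SucI_real[OF open_UNIV dF Cq]] .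
  define u where "u \<theta> = F \<theta> - \<theta>" for \<theta>
  have Cu: "Ck_open k UNIV u"
    unfolding u_def by (intro Ck_open_diff CF Ck_open_ident open_UNIV)
  have uper: "u (\<theta> + 2 * pi) = u \<theta>" for \<theta> by (simp add: u_def Fper)
  have du: "(u has_real_derivative q \<theta> - 1) (at \<theta>)" for \<theta>
    unfolding u_def by (rule derivative_eq_intros dF refl)+
  obtain umax where umax: "\<And>\<theta>. \<bar>u \<theta>\<bar> \<le> umax"
  proof -
    obtain a b where "\<And>x. u a \<le> u x" "\<And>x. u x \<le> u b"
      using periodic_attains[OF Ck_open_continuous_on[OF Cu] uper] by blast
    then have "\<bar>u \<theta>\<bar> \<le> \<bar>u a\<bar> + \<bar>u b\<bar>" for \<theta> by (smt (verit))
    then show ?thesis by (rule that)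
  qed
  define \<epsilon> where "\<epsilon> = 1 / (qmax + 1)"
  have qmax: "qmax > 0" using q[of 0] qbound(2)[of 0] by linarith
  then have \<epsilon>: "\<epsilon> > 0" "\<epsilon> * qmax < 1" by (auto simp: \<epsilon>_def divide_simps)
  show ?thesis
  proof (rule action_profile[OF \<epsilon>(1), of k])
    fix H H' :: "real \<Rightarrow> real" and a :: real
    assume a: "0 < a" "a < 1/4"
      and Hnear: "\<And>x. \<bar>x - 1/2\<bar> \<le> a \<Longrightarrow> H x = x - 1/2 \<and> H' x = 1"
      and Hfar: "\<And>x. \<bar>x - 1/2\<bar> \<ge> 1/4 \<Longrightarrow> H x = 0 \<and> H' x = 0"
      and dH: "\<And>x. (H has_real_derivative H' x) (at x)"
      and H': "\<And>x. - \<epsilon> \<le> H' x \<and> H' x \<le> 1" and CH': "Ck_open k UNIV H'"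
    have CH: "Ck_open k UNIV H"
      using Ck_open_SucD[OF Ck_open_SucI_real[OF open_UNIV dH CH']] .
    \<comment> \<open>If \<open>q \<theta>\<close> is at least 1, only a negative
      \<open>H' I\<close> could do harm, and \<open>\<epsilon>\<close> limits it; if it is less than
      1, the worst slope is 1, which leaves \<open>q \<theta>\<close> itself.\<close>
    have pos: "1 + H' I * (q \<theta> - 1) > 0" for I \<theta>
    proof (cases "q \<theta> \<ge> 1")
      case True
      have "- (\<epsilon> * qmax) \<le> - \<epsilon> * (q \<theta> - 1)"
        using mult_left_mono[of "q \<theta> - 1" qmax \<epsilon>] qbound(2)[of \<theta>] \<epsilon>(1) by simp
      also have "\<dots> \<le> H' I * (q \<theta> - 1)"
        using mult_right_mono[of "- \<epsilon>" "H' I" "q \<theta> - 1"] H' True by simp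
      finally show ?thesis using \<epsilon>(2) by linarith
    next
      case False
      have "q \<theta> - 1 \<le> H' I * (q \<theta> - 1)"
        using mult_right_mono_neg[of "H' I" 1 "q \<theta> - 1"] False H'[of I] by simp
      moreover have "- 1 < q \<theta> - 1" using q[of \<theta>] by simp
      ultimately have "- 1 < H' I * (q \<theta> - 1)" by (rule less_le_trans[rotated])
      then show ?thesis by linarith
    qed
    obtain Hmax where Hmax: "\<And>I. \<bar>H I\<bar> \<le> Hmax"
    proof -
      have "compact (H ` {1/4..3/4})"
        by (rule compact_continuous_image[OF continuous_on_subset[OF Ck_open_continuous_on[OF CH]]]) auto
      then obtain C where C: "\<And>x. x \<in> {1/4..3/4} \<Longrightarrow> \<bar>H x\<bar> \<le> C"
        using compact_imp_bounded bounded_iff by (metis image_eqI real_norm_def)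
      have "\<bar>H x\<bar> \<le> C" for x
      proof (cases "x \<in> {1/4..3/4}")
        case True
        then show ?thesis by (rule C)
      next
        case False
        then have "\<bar>x - 1/2\<bar> \<ge> 1/4" by auto
        with Hfar C[of "1/2"] show ?thesis by simp
      qed
      then show ?thesis by (rule that)
    qed

    text \<open>The generating function \<open>S(J, \<theta>) = J \<theta> + H(J) u(\<theta>)\<close> defines the symplectic map
      \<open>(\<partial>S/\<partial>\<theta>, \<theta>) \<mapsto> (J, \<partial>S/\<partial>J)\<close>; \<open>A\<close> and \<open>B\<close> parametrize its source and target by \<open>(J, \<theta>)\<close>.\<close>

    define A where "A x = (fst x + H (fst x) * (q (snd x) - 1), snd x)" for x :: "real \<times> real"
    define B where "B x = (fst x, snd x + H' (fst x) * u (snd x))" for x :: "real \<times> real"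
    \<comment> \<open>\<open>A\<close> preserves each line of constant angle and \<open>B\<close>
      each line of constant action, so bijectivity reduces to one-variable maps at bounded distance
      from the identity.\<close>
    have bA: "bij A"
    proof -
      have b: "bij (\<lambda>I. I + H I * (q \<theta> - 1))" for \<theta>
      proof (rule bij_increasing_near_id)
        show "((\<lambda>I. I + H I * (q \<theta> - 1)) has_real_derivative 1 + H' I * (q \<theta> - 1)) (at I)" for I
          by (rule derivative_eq_intros dH refl)+ simp
        show "\<bar>(I + H I * (q \<theta> - 1)) - I\<bar> \<le> Hmax * \<bar>q \<theta> - 1\<bar>" for I
          using mult_right_mono[OF Hmax[of I], of "\<bar>q \<theta> - 1\<bar>"] by (simp add: abs_mult)
      qed (rule pos)
      show ?thesis
      proof (rule bijI)
        show "inj A"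
        proof (rule injI)
          fix x y assume eq: "A x = A y"
          then have s: "snd x = snd y" by (simp add: A_def)
          with eq have "fst x = fst y"
            using injD[OF bij_is_inj[OF b[of "snd y"]], of "fst x" "fst y"] by (simp add: A_def)
          with s show "x = y" by (rule prod_eqI[rotated])
        qed
        show "surj A"
        proof (rule surj_def[THEN iffD2, rule_format])
          fix y :: "real \<times> real"
          obtain I where "fst y = I + H I * (q (snd y) - 1)"
            using surjD[OF bij_is_surj[OF b[of "snd y"]], of "fst y"] by blast
          then show "\<exists>x. y = A x" by (intro exI[of _ "(I, snd y)"]) (simp add: A_def prod_eq_iff)
        qed
      qed
    qed
    have bB: "bij B"
    proof -
      have b: "bij (\<lambda>\<theta>. \<theta> + H' I * u \<theta>)" for I
      proof (rule bij_increasing_near_id)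
        show "((\<lambda>\<theta>. \<theta> + H' I * u \<theta>) has_real_derivative 1 + H' I * (q \<theta> - 1)) (at \<theta>)" for \<theta>
          by (rule derivative_eq_intros du refl)+ simp
        show "\<bar>(\<theta> + H' I * u \<theta>) - \<theta>\<bar> \<le> \<bar>H' I\<bar> * umax" for \<theta>
          using mult_left_mono[OF umax[of \<theta>], of "\<bar>H' I\<bar>"] by (simp add: abs_mult)
      qed (rule pos)
      show ?thesis
      proof (rule bijI)
        show "inj B"
        proof (rule injI)
          fix x y assume eq: "B x = B y"
          then have s: "fst x = fst y" by (simp add: B_def)
          with eq have "snd x = snd y"
            using injD[OF bij_is_inj[OF b[of "fst y"]], of "snd x" "snd y"] by (simp add: B_def)
          with s show "x = y" by (rule prod_eqI)
        qed
        show "surj B"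
        proof (rule surj_def[THEN iffD2, rule_format])
          fix y :: "real \<times> real"
          obtain \<theta> where "snd y = \<theta> + H' (fst y) * u \<theta>"
            using surjD[OF bij_is_surj[OF b[of "fst y"]], of "snd y"] by blast
          then show "\<exists>x. y = B x" by (intro exI[of _ "(fst y, \<theta>)"]) (simp add: B_def prod_eq_iff)
        qed
      qed
    qed
    have Cfst: "Ck_open k UNIV (\<lambda>x. h (fst x))" and Csnd: "Ck_open k UNIV (\<lambda>x. h (snd x))"
      if "Ck_open k UNIV h" for h :: "real \<Rightarrow> real"
      by (rule Ck_open_compose[OF open_UNIV open_UNIV Ck_open_linear[OF open_UNIV bounded_linear_fst] that subset_UNIV]
          Ck_open_compose[OF open_UNIV open_UNIV Ck_open_linear[OF open_UNIV bounded_linear_snd] that subset_UNIV])+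
    have CA: "Ck_open k UNIV A"
      unfolding A_def
      by (intro Ck_open_Pair Ck_open_add Ck_open_mult Ck_open_diff Ck_open_const Cfst Csnd CH Cq
          Ck_open_fst Ck_open_snd Ck_open_ident open_UNIV)
    have CB: "Ck_open k UNIV B"
      unfolding B_def
      by (intro Ck_open_Pair Ck_open_add Ck_open_mult Cfst Csnd CH' Cu
          Ck_open_fst Ck_open_snd Ck_open_ident open_UNIV)
    \<comment> \<open>\<open>A\<close> and \<open>B\<close> are triangular, and both Jacobians are
      the mixed second derivative of S in J and \<theta>.\<close>
    have JA: "plane_jacobian A x = 1 + H' (fst x) * (q (snd x) - 1)" for x
    proof -
      note dx = bounded_linear_imp_has_derivative[OF bounded_linear_fst, of "at x"]
        bounded_linear_imp_has_derivative[OF bounded_linear_snd, of "at x"]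
      have "((\<lambda>\<theta>. q \<theta> - 1) has_real_derivative q' (snd x)) (at (snd x))"
        by (rule derivative_eq_intros dq refl)+ simp
      from has_derivative_Pair[OF has_derivative_add[OF dx(1) has_derivative_mult[OF
            has_derivative_comp_fst[OF dH] has_derivative_comp_snd[OF this]]] dx(2)]
      have "(A has_derivative (\<lambda>v. (fst v + (H (fst x) * (q' (snd x) * snd v) +
          H' (fst x) * fst v * (q (snd x) - 1)), snd v))) (at x)"
        unfolding A_def .
      from plane_jacobian_eq[OF this] show ?thesis by (simp add: dxdy_def)
    qed
    have "\<exists>H''. (H' has_real_derivative H'') (at I)" for I
      using Ck_open_differentiable[OF CH' assms(1)] by (simp add: real_differentiable_def)
    then obtain H'' where dH': "\<And>I. (H' has_real_derivative H'' I) (at I)" by metis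
    have JB: "plane_jacobian B x = 1 + H' (fst x) * (q (snd x) - 1)" for x
    proof -
      note dx = bounded_linear_imp_has_derivative[OF bounded_linear_fst, of "at x"]
        bounded_linear_imp_has_derivative[OF bounded_linear_snd, of "at x"]
      from has_derivative_Pair[OF dx(1) has_derivative_add[OF dx(2) has_derivative_mult[OF
            has_derivative_comp_fst[OF dH'] has_derivative_comp_snd[OF du]]]]
      have "(B has_derivative (\<lambda>v. (fst v, snd v + (H' (fst x) * ((q (snd x) - 1) * snd v) +
          H'' (fst x) * fst v * u (snd x))))) (at x)"
        unfolding B_def .
      from plane_jacobian_eq[OF this] show ?thesis by (simp add: dxdy_def)
    qed
    have CiA: "Ck_open k UNIV (inv A)"
      by (rule plane_diffeo[OF bA CA assms(1)]) (use pos in \<open>simp add: JA less_imp_neq[THEN not_sym]\<close>)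
    have CiB: "Ck_open k UNIV (inv B)"
      by (rule plane_diffeo[OF bB CB assms(1)]) (use pos in \<open>simp add: JB less_imp_neq[THEN not_sym]\<close>)
    have invA: "inv A (A x) = x" "A (inv A x) = x" and invB: "inv B (B x) = x" "B (inv B x) = x" for x
      using bA bB by (simp_all add: bij_is_inj bij_is_surj surj_f_inv_f)

    \<comment> \<open>The area-preserving map of the strip\<close>
    define \<Phi> where "\<Phi> x = B (inv A x)" for x
    define \<Psi> where "\<Psi> x = A (inv B x)" for x
    have \<Phi>A: "\<Phi> (A x) = B x" for x by (simp add: \<Phi>_def invA)
    have \<Phi>\<Psi>: "\<Phi> (\<Psi> x) = x" "\<Psi> (\<Phi> x) = x" for x by (simp_all add: \<Phi>_def \<Psi>_def invA invB)
    have C\<Phi>: "Ck_open k UNIV \<Phi>" unfolding \<Phi>_def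
      by (rule Ck_open_compose[OF open_UNIV open_UNIV CiA CB subset_UNIV])
    have C\<Psi>: "Ck_open k UNIV \<Psi>" unfolding \<Psi>_def
      by (rule Ck_open_compose[OF open_UNIV open_UNIV CiB CA subset_UNIV])
    \<comment> \<open>In the chain rule for \<open>\<Phi> (A x) = B x\<close> the equal nonzero
      Jacobians of \<open>A\<close> and \<open>B\<close> cancel.\<close>
    have J\<Phi>: "plane_jacobian \<Phi> x = 1" for x
    proof -
      have "plane_jacobian (\<lambda>x. \<Phi> (A x)) (inv A x) = plane_jacobian \<Phi> (A (inv A x)) * plane_jacobian A (inv A x)"
        by (intro plane_jacobian_compose Ck_open_differentiable[OF CA assms(1)]
            Ck_open_differentiable[OF C\<Phi> assms(1)] UNIV_I)
      moreover have "plane_jacobian (\<lambda>x. \<Phi> (A x)) (inv A x) = plane_jacobian A (inv A x)"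
        by (simp add: \<Phi>A JA JB)
      moreover have "plane_jacobian A (inv A x) \<noteq> 0"
        unfolding JA using pos less_imp_neq[THEN not_sym] by blast
      ultimately show ?thesis by (simp add: invA)
    qed
    have shiftA: "A (x + (0, 2 * pi)) = A x + (0, 2 * pi)" for x by (simp add: A_def qper)
    have shiftB: "B (x + (0, 2 * pi)) = B x + (0, 2 * pi)" for x by (simp add: B_def uper)
    have shift\<Phi>: "\<Phi> (x + (0, 2 * pi)) = \<Phi> x + (0, 2 * pi)" for x
      using \<Phi>A[of "inv A x + (0, 2 * pi)"] unfolding shiftA invA shiftB by (simp add: \<Phi>_def)
    have shift\<Psi>: "\<Psi> (x + (0, 2 * pi)) = \<Psi> x + (0, 2 * pi)" for x
      using shift\<Phi>[of "\<Psi> x"] \<Phi>\<Psi> by metis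
    \<comment> \<open>Here both \<open>H\<close> and \<open>H'\<close> vanish, the action being at
      distance at least 1/4 from 1/2.\<close>
    have "A x = x" "B x = x" if "fst x \<le> 1/4" for x
      using Hfar[of "fst x"] that by (simp_all add: A_def B_def)
    then have small: "\<Phi> x = x" "\<Psi> x = x" if "fst x \<le> 1/4" for x
      using that \<Phi>A \<Phi>\<Psi> by metis+
    have ann: "annular_map \<Phi>" "annular_map \<Psi>"
      using annular_mapI[of \<Phi> \<Psi>] annular_mapI[of \<Psi> \<Phi>] shift\<Phi> shift\<Psi> small \<Phi>\<Psi> by blast+

    \<comment> \<open>Descent to the plane\<close>
    define \<phi> where "\<phi> = descend \<Phi>"
    define \<psi> where "\<psi> = descend \<Psi>"
    have \<phi>\<psi>: "\<phi> (\<psi> p) = p" "\<psi> (\<phi> p) = p" for p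
      unfolding \<phi>_def \<psi>_def using ann \<Phi>\<Psi> by (simp_all add: descend_inverse)
    have C\<phi>: "Ck_open k UNIV \<phi>" and C\<psi>: "Ck_open k UNIV \<psi>"
      unfolding \<phi>_def \<psi>_def by (rule Ck_open_descend ann C\<Phi> C\<Psi>)+
    have "bij \<phi>" using \<phi>\<psi> by (intro o_bij[of \<psi>]) auto
    moreover have "inv \<phi> = \<psi>" using \<phi>\<psi> by (intro inv_equality)
    ultimately have "Ck_diffeo k UNIV UNIV \<phi>"
      unfolding Ck_diffeo_def using C\<phi> C\<psi> by (simp add: Ck_on_open_iff)
    moreover have "dxdy (frechet_derivative \<phi> (at p) v) (frechet_derivative \<phi> (at p) w) = dxdy v w" for p v w
      using dxdy_derivative[OF Ck_open_differentiable[OF C\<phi> assms(1)], of p]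
        plane_jacobian_descend[OF ann(1) C\<Phi> assms(1) J\<Phi>] by (simp add: \<phi>_def)
    ultimately have symp: "Ck_symplectomorphism k \<phi>" unfolding Ck_symplectomorphism_def by blast

    \<comment> \<open>The angular form near the circle\<close>
    define J where "J r \<theta> = 1/2 + (r\<^sup>2 / 2 - 1/2) / q \<theta>" for r \<theta>
    \<comment> \<open>With this width, division by \<open>q \<theta>\<close> leaves
      \<open>J r \<theta>\<close> within \<open>a\<close> of 1/2 for every angle.\<close>
    define U where "U = {p :: real \<times> real. \<bar>(norm p)\<^sup>2 / 2 - 1/2\<bar> < a * qmin}"
    have oU: "open U" unfolding U_def by (intro open_Collect_less continuous_intros) auto
    have S1U: "S1 \<subseteq> U" using a qbound(3) by (auto simp: U_def)
    have form: "J r \<theta> > 0 \<and> \<phi> (polar r \<theta>) = polar (sqrt (2 * J r \<theta>)) (F \<theta>)"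
      if "r > 0" "polar r \<theta> \<in> U" for r \<theta>
    proof -
      have "\<bar>r\<^sup>2 / 2 - 1/2\<bar> < a * qmin" using that by (simp add: U_def norm_polar)
      also have "\<dots> \<le> a * q \<theta>" using a qbound(1) by (simp add: mult_left_mono)
      finally have "\<bar>r\<^sup>2 / 2 - 1/2\<bar> / q \<theta> < a" using q[of \<theta>] by (simp only: pos_divide_less_eq)
      moreover have "\<bar>J r \<theta> - 1/2\<bar> = \<bar>r\<^sup>2 / 2 - 1/2\<bar> / q \<theta>"
        using q[of \<theta>] unfolding J_def by simp
      ultimately have near: "\<bar>J r \<theta> - 1/2\<bar> < a" by simp
      then have Jpos: "J r \<theta> > 0" using a by linarith
      \<comment> \<open>\<open>J\<close> was chosen to solve this equation: where H(J) = J - 1/2,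
        the first component of \<open>A\<close> is 1/2 + (J - 1/2) q.\<close>
      have "(J r \<theta> - 1/2) * q \<theta> = r\<^sup>2 / 2 - 1/2" using q[of \<theta>] unfolding J_def by simp
      then have "J r \<theta> + (J r \<theta> - 1/2) * (q \<theta> - 1) = r\<^sup>2 / 2"
        by (simp add: right_diff_distrib)
      then have "A (J r \<theta>, \<theta>) = (r\<^sup>2 / 2, \<theta>)" using Hnear[of "J r \<theta>"] near by (simp add: A_def)
      moreover have "B (J r \<theta>, \<theta>) = (J r \<theta>, F \<theta>)" using Hnear[of "J r \<theta>"] near by (simp add: B_def u_def)
      ultimately have "\<Phi> (r\<^sup>2 / 2, \<theta>) = (J r \<theta>, F \<theta>)" using \<Phi>A by metis
      then have "\<phi> (polar r \<theta>) = action_angle (J r \<theta>, F \<theta>)"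
        using descend_action_angle[OF ann(1), of "(r\<^sup>2 / 2, \<theta>)"] that(1)
        by (simp add: \<phi>_def action_angle_polar)
      with Jpos show ?thesis by (simp add: action_angle_def)
    qed
    have "angular_form_near_S1 f \<phi>"
      unfolding angular_form_near_S1_def
    proof (intro exI[of _ U] exI[of _ "\<lambda>r \<theta>. sqrt (2 * J r \<theta>)"] conjI oU S1U allI impI)
      fix r \<theta> \<alpha> :: real
      assume r: "r > 0" "polar r \<theta> \<in> U" and "f (polar 1 \<theta>) = polar 1 \<alpha>"
      then have "polar 1 (F \<theta>) = polar 1 \<alpha>" by (simp add: fF)
      \<comment> \<open>Agreement of the two angles modulo full turns does not depend on the
        radius.\<close>
      then have "polar s (F \<theta>) = polar s \<alpha>" for s by (simp add: polar_def)
      with form[OF r] show "sqrt (2 * J r \<theta>) > 0" "\<phi> (polar r \<theta>) = polar (sqrt (2 * J r \<theta>)) \<alpha>"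
        by simp_all
    qed
    moreover have "\<phi> p = f p" if "p \<in> S1" for p
    proof -
      obtain \<theta> where "p = polar (norm p) \<theta>" by (rule polar_exists)
      with that have p: "p = polar 1 \<theta>" by simp
      then have "polar 1 \<theta> \<in> U" using that S1U by blast
      \<comment> \<open>At r = 1 the value of \<open>J\<close> is 1/2, so the image has radius
        1.\<close>
      from form[OF zero_less_one this] show ?thesis by (simp add: p fF J_def)
    qed
    ultimately show ?thesis using symp by blast
  qed
qed

end
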